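(* Let $\alpha\in(0,1)$ and let $t_0<t_1$ be real numbers. Let $p>1/(1-\alpha)$ and $p\geq 2$. If $f\in L^p(t_0,t_1;\mathbb{R})$, $g_{1-\alpha}*f\in W^{1,2}(t_0,t_1;\mathbb{R})$ and $g_{1-\alpha}*f^2\in W^{1,1}(t_0,t_1;\mathbb{R})$, then $$D_{t_0,t}^\alpha\big[f(t)\big]^2\leq 2\Big[D_{t_0,t}^\alpha f(t)\Big]f(t),\quad\text{for almost every }t\in[t_0,t_1].$$
   Context: For $\beta>0$, $g_\beta:\mathbb{R}\to\mathbb{R}$ is $g_\beta(t)=t^{\beta-1}/\Gamma(\beta)$ for $t>0$ and $g_\beta(t)=0$ for $t\le 0$. A function $f$ on $[t_0,t_1]$ is extended by zero outside $[t_0,t_1]$, so that $(g_{1-\alpha}*f)(t)=\frac{1}{\Gamma(1-\alpha)}\int_{t_0}^t(t-s)^{-\alpha}f(s)\,ds$ for a.e. $t\in[t_0,t_1]$. If $f\in L^1(t_0,t_1)$ and $g_{1-\alpha}*f\in W^{1,1}(t_0,t_1)$, the Riemann-Liouville fractional derivative of order $\alpha\in(0,1)$ at $t_0$ is $D_{t_0,t}^\alpha f(t)=\frac{d}{dt}(g_{1-\alpha}*f)(t)$ (weak derivative), for a.e. $t\in[t_0,t_1]$. $D_{t_0,t}^\alpha[f(t)]^2$ denotes the derivative of the function $t\mapsto f(t)^2$. *)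

theory Defs
  imports "HOL-Analysis.Analysis"
begin

definition gker :: "real \<Rightarrow> real \<Rightarrow> real" where
  "gker \<beta> t = (if t > 0 then t powr (\<beta> - 1) / Gamma \<beta> else 0)"

definition zero_ext :: "real \<Rightarrow> real \<Rightarrow> (real \<Rightarrow> real) \<Rightarrow> real \<Rightarrow> real" where
  "zero_ext a b f = (\<lambda>s. if s \<in> {a..b} then f s else 0)"

text \<open>If the integrand is not integrable, the Bochner integral below is 0. For the kernels
  \<open>gker \<beta>\<close> and integrable \<open>h\<close> with bounded support this happens only for \<open>t\<close> in a null set.\<close>

definition convolution :: "(real \<Rightarrow> real) \<Rightarrow> (real \<Rightarrow> real) \<Rightarrow> real \<Rightarrow> real" where
  "convolution g h t = (LINT s|lebesgue. g (t - s) * h s)"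

definition gconv :: "real \<Rightarrow> real \<Rightarrow> real \<Rightarrow> (real \<Rightarrow> real) \<Rightarrow> real \<Rightarrow> real" where
  "gconv \<beta> a b f = convolution (gker \<beta>) (zero_ext a b f)"

lemma gconv_eq_integral:
  assumes "t \<in> {a..b}"
  shows "gconv (1 - \<alpha>) a b f t =
    1 / Gamma (1 - \<alpha>) * (LINT s:{a..t}|lebesgue. (t - s) powr (- \<alpha>) * f s)"
proof -
  have "gker (1 - \<alpha>) (t - s) * zero_ext a b f s =
      1 / Gamma (1 - \<alpha>) * (indicator {a..t} s *\<^sub>R ((t - s) powr (- \<alpha>) * f s))" for s
    using assms by (cases "s < t"; cases "s = t") (auto simp: gker_def zero_ext_def indicator_def)
  then show ?thesis
    unfolding gconv_def convolution_def set_lebesgue_integral_def by simp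
qed

text \<open>\<open>L\<^sup>p(a,b)\<close> for finite \<open>p\<close>. Its elements are functions, not classes of functions modulo
  equality almost everywhere, and their values outside \<open>[a,b]\<close> are irrelevant.\<close>

definition Lp_space :: "real \<Rightarrow> real \<Rightarrow> real \<Rightarrow> (real \<Rightarrow> real) set" where
  "Lp_space p a b = {u. u \<in> borel_measurable (lebesgue_on {a..b}) \<and>
     integrable (lebesgue_on {a..b}) (\<lambda>t. \<bar>u t\<bar> powr p)}"

definition test_function :: "real \<Rightarrow> real \<Rightarrow> (real \<Rightarrow> real) \<Rightarrow> bool" where
  "test_function a b \<phi> \<longleftrightarrow>
     (\<forall>n t. (deriv ^^ n) \<phi> differentiable (at t)) \<and> closure {t. \<phi> t \<noteq> 0} \<subseteq> {a<..<b}"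

definition locally_integrable :: "real \<Rightarrow> real \<Rightarrow> (real \<Rightarrow> real) \<Rightarrow> bool" where
  "locally_integrable a b u \<longleftrightarrow>
     (\<forall>c d. a < c \<and> d < b \<longrightarrow> u absolutely_integrable_on {c..d})"

definition has_weak_derivative ::
    "real \<Rightarrow> real \<Rightarrow> (real \<Rightarrow> real) \<Rightarrow> (real \<Rightarrow> real) \<Rightarrow> bool" where
  "has_weak_derivative a b u v \<longleftrightarrow>
     locally_integrable a b u \<and> locally_integrable a b v \<and>
     (\<forall>\<phi>. test_function a b \<phi> \<longrightarrow>
        (LINT t|lebesgue_on {a..b}. u t * deriv \<phi> t) = - (LINT t|lebesgue_on {a..b}. v t * \<phi> t))"

text \<open>A weak derivative is unique only up to a null set. The choice below picks one
  representative, so \<open>weak_deriv\<close> is meaningful only in statements that hold almost everywhere.\<close>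

definition weak_deriv :: "real \<Rightarrow> real \<Rightarrow> (real \<Rightarrow> real) \<Rightarrow> real \<Rightarrow> real" where
  "weak_deriv a b u = (SOME v. has_weak_derivative a b u v)"

definition W1p_space :: "real \<Rightarrow> real \<Rightarrow> real \<Rightarrow> (real \<Rightarrow> real) set" where
  "W1p_space p a b =
     {u \<in> Lp_space p a b. \<exists>v \<in> Lp_space p a b. has_weak_derivative a b u v}"

text \<open>The interval end \<open>b\<close> is an argument because functions are extended by zero outside \<open>[a,b]\<close>
  and the weak derivative is taken on \<open>(a,b)\<close>. This is the Riemann-Liouville derivative
  provided \<open>f \<in> Lp_space 1 a b\<close> and \<open>gconv (1 - \<alpha>) a b f \<in> W1p_space 1 a b\<close>.\<close>

definition RL_deriv :: "real \<Rightarrow> real \<Rightarrow> real \<Rightarrow> (real \<Rightarrow> real) \<Rightarrow> real \<Rightarrow> real" where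
  "RL_deriv \<alpha> a b f = weak_deriv a b (gconv (1 - \<alpha>) a b f)"

end

theory Submission
  imports Defs
begin

text \<open>
  Write \<open>k\<close> for the kernel of order \<open>1 - \<alpha>\<close>, \<open>F = k * f\<close>, \<open>G = k * f\<^sup>2\<close> and
  \<open>\<kappa> r = k (t + h - r) - k (t - r)\<close>. Since \<open>f r\<^sup>2 - 2 f t f r = (f r - f t)\<^sup>2 - f t\<^sup>2\<close>, the
  quantity \<open>G (t + h) - G t - 2 f t (F (t + h) - F t)\<close> is the integral of
  \<open>\<kappa> r ((f r - f t)\<^sup>2 - f t\<^sup>2)\<close>. As \<open>\<kappa>\<close> has nonnegative integral and is negative for \<open>r < t\<close>, this is
  at most the contribution \<open>E h t\<close> of \<open>k (t + h - r) (f r - f t)\<^sup>2\<close> over \<open>t < r < t + h\<close>. After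
  division by \<open>h\<close> the left-hand side tends almost everywhere to \<open>D f\<^sup>2 - 2 f D f\<close>, so it suffices
  that \<open>E h / h\<close> tends to 0 in \<open>L\<^sup>1\<close>; Fatou's lemma then gives the claim.

  By Hoelder's inequality, \<open>p > 1 / (1 - \<alpha>)\<close> forces \<open>F\<close> to vanish at \<open>t\<^sub>0\<close>. Hence
  \<open>F = 1 * v\<close> with \<open>v\<close> the weak derivative of \<open>F\<close>, and Abel inversion yields \<open>f = g * v\<close> with \<open>g\<close> the
  kernel of order \<open>\<alpha>\<close> and \<open>v \<in> L\<^sup>2\<close>. Young's inequality for \<open>L\<^sup>1 * L\<^sup>2\<close> bounds the squared \<open>L\<^sup>2\<close> norm of
  \<open>f (\<cdot> + s) - f\<close> by a multiple of \<open>s\<close> to the power \<open>2 \<alpha>\<close>, and the \<open>L\<^sup>1\<close> norm of \<open>E h / h\<close> is then of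
  order \<open>h\<close> to the power \<open>\<alpha>\<close>.
\<close>

section \<open>Smooth test functions\<close>

text \<open>With \<open>P = 1\<close> this is the classical flat function exp (-1/y). The polynomial
  factor makes the family closed under differentiation.\<close>

definition exp_recip :: "real poly \<Rightarrow> real \<Rightarrow> real" where
  "exp_recip P y = (if y > 0 then poly P (1 / y) * exp (- (1 / y)) else 0)"

lemma poly_mult_exp_minus_tendsto_0:
  "((\<lambda>z. poly P z * exp (- z)) \<longlongrightarrow> 0) at_top" for P :: "real poly"
proof -
  have "((\<lambda>z. \<Sum>i\<le>degree P. coeff P i * (z ^ i / exp z)) \<longlongrightarrow> (\<Sum>i\<le>degree P. coeff P i * 0)) at_top"
    by (intro tendsto_intros tendsto_power_div_exp_0)
  then show ?thesis
    by (simp add: poly_altdef exp_minus sum_distrib_right divide_inverse mult.assoc)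
qed

text \<open>With z = 1/y one has dz/dy = - z^2, so the chain rule turns P z exp (-z) into z^2 (P z -
  P' z) exp (-z). At 0 every member is flat, because exp (-z) decays faster than any polynomial
  grows.\<close>

lemma exp_recip_has_derivative:
  "(exp_recip P has_real_derivative exp_recip ([:0, 0, 1:] * (P - pderiv P)) y) (at y)"
proof -
  consider "y < 0" | "y = 0" | "y > 0" by linarith
  then show ?thesis
  proof cases
    case 1
    have "((\<lambda>_. 0) has_real_derivative 0) (at y)" by simp
    then have "(exp_recip P has_real_derivative 0) (at y)"
      by (rule has_field_derivative_transform_within_open[of _ _ _ "{..<0}"])
        (use 1 in \<open>auto simp: exp_recip_def\<close>)
    then show ?thesis using 1 by (simp add: exp_recip_def)
  next
    case 3
    then have D: "((\<lambda>y. 1 / y) has_real_derivative - (1 / y)\<^sup>2) (at y)"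
      by (auto intro!: derivative_eq_intros simp: power2_eq_square)
    have "((\<lambda>y. poly P (1 / y) * exp (- (1 / y))) has_real_derivative
        poly (pderiv P) (1 / y) * (- (1 / y)\<^sup>2) * exp (- (1 / y)) +
        exp (- (1 / y)) * - (- (1 / y)\<^sup>2) * poly P (1 / y)) (at y)"
      by (intro DERIV_mult DERIV_chain2[OF poly_DERIV D] DERIV_fun_exp DERIV_minus D)
    also have "poly (pderiv P) (1 / y) * (- (1 / y)\<^sup>2) * exp (- (1 / y)) +
        exp (- (1 / y)) * - (- (1 / y)\<^sup>2) * poly P (1 / y) = exp_recip ([:0, 0, 1:] * (P - pderiv P)) y"
      using 3 by (simp add: exp_recip_def power2_eq_square algebra_simps)
    finally have "((\<lambda>y. poly P (1 / y) * exp (- (1 / y))) has_real_derivative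
      exp_recip ([:0, 0, 1:] * (P - pderiv P)) y) (at y)" .
    then show ?thesis
      by (rule has_field_derivative_transform_within_open[of _ _ _ "{0<..}"])
        (use 3 in \<open>auto simp: exp_recip_def\<close>)
  next
    case 2
    \<comment> \<open>Dividing by \<open>h\<close> in the difference quotient contributes one more
      factor 1/h, hence \<open>pCons 0 P\<close>.\<close>
    have "((\<lambda>z. poly (pCons 0 P) z * exp (- z)) \<longlongrightarrow> 0) at_top"
      by (rule poly_mult_exp_minus_tendsto_0)
    then have "((\<lambda>h. poly (pCons 0 P) (inverse h) * exp (- (inverse h))) \<longlongrightarrow> 0) (at_right 0)"
      by (rule filterlim_compose) (rule filterlim_inverse_at_top_right)
    moreover have "\<forall>\<^sub>F h in at_right 0. poly (pCons 0 P) (inverse h) * exp (- (inverse h))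
        = (exp_recip P h - exp_recip P 0) / h"
      by (auto simp: eventually_at_right_field exp_recip_def divide_inverse intro!: exI[of _ 1])
    ultimately have R: "((\<lambda>h. (exp_recip P h - exp_recip P 0) / h) \<longlongrightarrow> 0) (at_right 0)"
      by (simp add: filterlim_cong)
    have "\<forall>\<^sub>F h in at_left 0. 0 = (exp_recip P h - exp_recip P 0) / h"
      by (auto simp: eventually_at_left_field exp_recip_def intro!: exI[of _ "-1"])
    then have "((\<lambda>h. (exp_recip P h - exp_recip P 0) / h) \<longlongrightarrow> 0) (at_left 0)"
      by (rule Lim_transform_eventually[OF tendsto_const])
    with R show ?thesis
      using 2 by (simp add: DERIV_def exp_recip_def filterlim_at_split)
  qed
qed

text \<open>The set is closed under differentiation by induction, so iterated derivatives never have
  to be computed. Affine arguments are built into the generator to provide reflections and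
  translations without a composition rule.\<close>

inductive_set smooth_algebra :: "(real \<Rightarrow> real) set" where
  exp_recip: "(\<lambda>x. exp_recip P (m * x + c)) \<in> smooth_algebra"
| const: "(\<lambda>x. c) \<in> smooth_algebra"
| add: "f \<in> smooth_algebra \<Longrightarrow> g \<in> smooth_algebra \<Longrightarrow> (\<lambda>x. f x + g x) \<in> smooth_algebra"
| mult: "f \<in> smooth_algebra \<Longrightarrow> g \<in> smooth_algebra \<Longrightarrow> (\<lambda>x. f x * g x) \<in> smooth_algebra"

lemma smooth_algebra_deriv:
  assumes "f \<in> smooth_algebra"
  shows "\<exists>f' \<in> smooth_algebra. \<forall>x. (f has_real_derivative f' x) (at x)"
  using assms
proof induction
  case (exp_recip P m c)
  have "((\<lambda>x. exp_recip P (m * x + c)) has_real_derivative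
      exp_recip ([:0, 0, 1:] * (P - pderiv P)) (m * x + c) * m) (at x)" for x
    by (rule DERIV_chain2[OF exp_recip_has_derivative]) (auto intro!: derivative_eq_intros)
  then show ?case
    by (intro bexI[of _ "\<lambda>x. exp_recip ([:0, 0, 1:] * (P - pderiv P)) (m * x + c) * m"])
      (auto intro: smooth_algebra.intros)
next
  case (const c)
  then show ?case by (intro bexI[of _ "\<lambda>x. 0"]) (auto intro: smooth_algebra.intros)
next
  case (add f g)
  then obtain f' g' where "f' \<in> smooth_algebra" "g' \<in> smooth_algebra"
    "\<And>x. (f has_real_derivative f' x) (at x)" "\<And>x. (g has_real_derivative g' x) (at x)"
    by blast
  then show ?case
    by (intro bexI[of _ "\<lambda>x. f' x + g' x"]) (auto intro: smooth_algebra.intros DERIV_add)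
next
  case (mult f g)
  then obtain f' g' where "f' \<in> smooth_algebra" "g' \<in> smooth_algebra"
    "\<And>x. (f has_real_derivative f' x) (at x)" "\<And>x. (g has_real_derivative g' x) (at x)"
    by blast
  then show ?case using mult(1,2)
    by (intro bexI[of _ "\<lambda>x. f' x * g x + g' x * f x"])
      (auto intro: smooth_algebra.intros DERIV_mult)
qed

lemma smooth_algebra_funpow_deriv:
  assumes "f \<in> smooth_algebra"
  shows "(deriv ^^ n) f \<in> smooth_algebra"
proof (induction n)
  case (Suc n)
  from smooth_algebra_deriv[OF this] obtain f' where "f' \<in> smooth_algebra"
    "\<forall>x. ((deriv ^^ n) f has_real_derivative f' x) (at x)" by blast
  moreover from this have "deriv ((deriv ^^ n) f) = f'"
    by (intro ext DERIV_imp_deriv) auto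
  ultimately show ?case by simp
qed (simp add: assms)

lemma smooth_algebra_differentiable:
  assumes "f \<in> smooth_algebra"
  shows "f differentiable (at x)"
  using smooth_algebra_deriv[OF assms] by (auto simp: real_differentiable_def)

lemma smooth_algebra_power:
  "f \<in> smooth_algebra \<Longrightarrow> (\<lambda>x. f x ^ n) \<in> smooth_algebra"
  by (induction n) (auto intro: smooth_algebra.intros)

lemma smooth_algebra_diff:
  assumes "f \<in> smooth_algebra" "g \<in> smooth_algebra"
  shows "(\<lambda>x. f x - g x) \<in> smooth_algebra"
  using smooth_algebra.add[OF assms(1) smooth_algebra.mult[OF smooth_algebra.const[of "-1"] assms(2)]]
  by simp

lemma smooth_algebra_translate:
  assumes "f \<in> smooth_algebra"
  shows "(\<lambda>x. f (x - c)) \<in> smooth_algebra"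
  using assms
proof induction
  case (exp_recip P m d)
  show ?case
    using smooth_algebra.exp_recip[of P m "d - m * c"] by (simp add: algebra_simps)
qed (auto intro: smooth_algebra.intros)

text \<open>The rules of \<open>smooth_algebra\<close> do not produce antiderivatives. It is enough
  that the first derivative is a member, since all higher derivatives are then members too.\<close>

lemma test_function_antiderivative:
  assumes "\<psi> \<in> smooth_algebra"
    and deriv: "\<And>x. (\<phi> has_real_derivative \<psi> x) (at x)"
    and supp: "\<And>x. x \<notin> {c..d} \<Longrightarrow> \<phi> x = 0"
    and "a < c" "d < b"
  shows "test_function a b \<phi>"
proof -
  have eq: "deriv \<phi> = \<psi>"
    using deriv by (intro ext DERIV_imp_deriv) auto
  have "(deriv ^^ n) \<phi> differentiable (at t)" for n t
  proof (cases n)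
    case 0
    then show ?thesis using deriv by (auto simp: real_differentiable_def)
  next
    case (Suc m)
    then have "(deriv ^^ n) \<phi> = (deriv ^^ m) \<psi>"
      by (simp add: funpow_swap1 eq del: funpow.simps(2) add: funpow_Suc_right)
    then show ?thesis
      using smooth_algebra_differentiable[OF smooth_algebra_funpow_deriv[OF assms(1)]] by simp
  qed
  moreover have "closure {t. \<phi> t \<noteq> 0} \<subseteq> {c..d}"
    by (rule closure_minimal) (use supp in blast, simp)
  ultimately show ?thesis
    using assms(4,5) by (fastforce simp: test_function_def)
qed

text \<open>As \<open>n\<close> grows, these smooth functions increase to the indicator of \<open>(0, \<delta>)\<close>.\<close>

definition plateau :: "real \<Rightarrow> nat \<Rightarrow> real \<Rightarrow> real" where
  "plateau \<delta> n x = 1 - (1 - exp_recip 1 x * exp_recip 1 (\<delta> - x)) ^ n"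

text \<open>A smooth step that is 0 on the left and constant to the right of
  \<open>\<delta>\<close>. Writing it as a Lebesgue integral over a half-line lets the limit in
  \<open>n\<close> follow from dominated convergence.\<close>

definition plateau_int :: "real \<Rightarrow> nat \<Rightarrow> real \<Rightarrow> real" where
  "plateau_int \<delta> n x = (LINT y|lborel. plateau \<delta> n y * indicator {..x} y)"

lemma exp_recip_1_bounds: "0 \<le> exp_recip 1 x" "exp_recip 1 x \<le> 1"
  by (auto simp: exp_recip_def)

lemma plateau_smooth: "plateau \<delta> n \<in> smooth_algebra"
proof -
  have "(\<lambda>x. exp_recip 1 (1 * x + 0) * exp_recip 1 ((-1) * x + \<delta>)) \<in> smooth_algebra"
    by (intro smooth_algebra.intros)
  then have "(\<lambda>x. 1 - (1 - exp_recip 1 x * exp_recip 1 (\<delta> - x)) ^ n) \<in> smooth_algebra"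
    by (intro smooth_algebra_diff smooth_algebra.const smooth_algebra_power) (simp add: algebra_simps)
  then show ?thesis by (simp add: plateau_def[abs_def])
qed

lemma plateau_continuous: "continuous_on S (plateau \<delta> n)"
  using smooth_algebra_differentiable[OF plateau_smooth]
  by (metis differentiable_imp_continuous_within continuous_at_imp_continuous_on)

lemma plateau_measurable [measurable]: "plateau \<delta> n \<in> borel_measurable borel"
  by (intro borel_measurable_continuous_onI plateau_continuous)

lemma plateau_nonneg: "0 \<le> plateau \<delta> n x"
  and plateau_le_1: "plateau \<delta> n x \<le> 1"
proof -
  have "0 \<le> exp_recip 1 x * exp_recip 1 (\<delta> - x)" "exp_recip 1 x * exp_recip 1 (\<delta> - x) \<le> 1"
    by (auto intro!: mult_nonneg_nonneg mult_le_one exp_recip_1_bounds)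
  then show "0 \<le> plateau \<delta> n x" "plateau \<delta> n x \<le> 1"
    by (auto simp: plateau_def intro!: power_le_one)
qed

lemma plateau_eq_0: "x \<notin> {0<..<\<delta>} \<Longrightarrow> plateau \<delta> n x = 0"
  by (auto simp: plateau_def exp_recip_def)

lemma plateau_tendsto: "(\<lambda>n. plateau \<delta> n x) \<longlonglongrightarrow> indicator {0<..<\<delta>} x"
proof (cases "0 < x \<and> x < \<delta>")
  case True
  then have "0 < exp_recip 1 x * exp_recip 1 (\<delta> - x)"
    by (auto simp: exp_recip_def)
  moreover have "exp_recip 1 x * exp_recip 1 (\<delta> - x) \<le> 1"
    by (auto intro!: mult_nonneg_nonneg mult_le_one exp_recip_1_bounds)
  ultimately have "(\<lambda>n. 1 - (1 - exp_recip 1 x * exp_recip 1 (\<delta> - x)) ^ n) \<longlonglongrightarrow> 1 - 0"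
    by (intro tendsto_intros LIMSEQ_power_zero) auto
  then show ?thesis using True by (simp add: plateau_def)
next
  case False
  then have "plateau \<delta> n x = 0" for n
    by (intro plateau_eq_0) auto
  moreover have "indicator {0<..<\<delta>} x = (0::real)"
    using False by (auto simp: indicator_def)
  ultimately show ?thesis by simp
qed

lemma integrable_indicator_Ioo: "integrable lborel (indicator {0<..<\<delta>} :: real \<Rightarrow> real)"
  by (cases "0 \<le> \<delta>") (auto simp: integrable_indicator_iff)

lemma plateau_integrable: "integrable lborel (\<lambda>y. plateau \<delta> n y * indicator {..x} y)"
proof (rule Bochner_Integration.integrable_bound[OF integrable_indicator_Ioo[of \<delta>]])
  show "AE y in lborel. norm (plateau \<delta> n y * indicator {..x} y) \<le> norm (indicator {0<..<\<delta>} y :: real)"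
    by (auto simp: indicator_def plateau_nonneg plateau_le_1 plateau_eq_0)
qed measurable

lemma plateau_int_eq_0: "x \<le> 0 \<Longrightarrow> plateau_int \<delta> n x = 0"
proof -
  assume "x \<le> 0"
  then have "plateau \<delta> n y * indicator {..x} y = 0" for y
    by (cases "y \<in> {0<..<\<delta>}") (auto simp: indicator_def plateau_eq_0)
  then show ?thesis unfolding plateau_int_def by (simp only: Bochner_Integration.integral_zero)
qed

lemma plateau_int_eq_const: "\<delta> \<le> x \<Longrightarrow> plateau_int \<delta> n x = plateau_int \<delta> n \<delta>"
proof -
  assume "\<delta> \<le> x"
  then have "plateau \<delta> n y * indicator {..x} y = plateau \<delta> n y * indicator {..\<delta>} y" for y
    by (cases "y \<in> {0<..<\<delta>}") (auto simp: indicator_def plateau_eq_0)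
  then show ?thesis unfolding plateau_int_def by (simp only:)
qed

lemma plateau_int_bounds:
  assumes "0 < \<delta>"
  shows "0 \<le> plateau_int \<delta> n x" "plateau_int \<delta> n x \<le> \<delta>"
proof -
  show "0 \<le> plateau_int \<delta> n x"
    unfolding plateau_int_def by (intro integral_nonneg_AE) (auto simp: plateau_nonneg)
  have "plateau_int \<delta> n x \<le> (LINT y|lborel. indicator {0<..<\<delta>} y)"
    unfolding plateau_int_def
    by (rule integral_mono[OF plateau_integrable integrable_indicator_Ioo])
      (auto simp: indicator_def plateau_nonneg plateau_le_1 plateau_eq_0)
  then show "plateau_int \<delta> n x \<le> \<delta>" using assms by simp
qed

lemma plateau_int_tendsto:
  assumes "0 < \<delta>"
  shows "(\<lambda>n. plateau_int \<delta> n x) \<longlonglongrightarrow> max 0 (min x \<delta>)"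
proof -
  have "(\<lambda>n. plateau_int \<delta> n x) \<longlonglongrightarrow> (LINT y|lborel. indicator {0<..<\<delta>} y * indicator {..x} y)"
    unfolding plateau_int_def
  proof (rule integral_dominated_convergence[where w="indicator {0<..<\<delta>}"])
    show "AE y in lborel. (\<lambda>n. plateau \<delta> n y * indicator {..x} y) \<longlonglongrightarrow> indicator {0<..<\<delta>} y * indicator {..x} y"
      by (intro always_eventually allI tendsto_mult plateau_tendsto tendsto_const)
    show "AE y in lborel. norm (plateau \<delta> n y * indicator {..x} y) \<le> indicator {0<..<\<delta>} y" for n
      by (auto simp: indicator_def plateau_nonneg plateau_le_1 plateau_eq_0)
  qed (auto intro: integrable_indicator_Ioo)
  also have "(\<lambda>y. indicator {0<..<\<delta>} y * indicator {..x} y :: real) = indicator ({0<..<\<delta>} \<inter> {..x})"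
    by (auto simp: indicator_def)
  also have "(LINT y|lborel. indicator ({0<..<\<delta>} \<inter> {..x}) y) = max 0 (min x \<delta>)"
  proof -
    consider "x \<le> 0" | "0 < x" "x < \<delta>" | "\<delta> \<le> x" by linarith
    then show ?thesis
    proof cases
      case 1
      then have "{0<..<\<delta>} \<inter> {..x} = {}" by auto
      then show ?thesis using 1 assms by simp
    next
      case 2
      then have "{0<..<\<delta>} \<inter> {..x} = {0<..x}" by auto
      then show ?thesis using 2 by simp
    next
      case 3
      then have "{0<..<\<delta>} \<inter> {..x} = {0<..<\<delta>}" by auto
      then show ?thesis using 3 assms by simp
    qed
  qed
  finally show ?thesis .
qed

lemma plateau_int_has_derivative:
  "(plateau_int \<delta> n has_real_derivative plateau \<delta> n x) (at x)"
proof -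
  \<comment> \<open>A base point strictly below both 0 and \<open>x\<close>: the integrand vanishes
    to its left, and \<open>x\<close> is interior to the half-line that starts there.\<close>
  define c where "c = min x 0 - 1"
  have "((\<lambda>x. integral {c..x} (plateau \<delta> n)) has_real_derivative plateau \<delta> n x) (at x within {c..x+1})"
    by (rule integral_has_real_derivative) (auto simp: c_def intro: plateau_continuous)
  then have D: "((\<lambda>x. integral {c..x} (plateau \<delta> n)) has_real_derivative plateau \<delta> n x) (at x)"
    by (subst (asm) at_within_Icc_at) (auto simp: c_def)
  have eq: "integral {c..z} (plateau \<delta> n) = plateau_int \<delta> n z" if "z > c" for z
  proof -
    have "set_integrable lborel {c..z} (plateau \<delta> n)"
      by (intro borel_integrable_atLeastAtMost' plateau_continuous)
    then have "integral {c..z} (plateau \<delta> n) = (LINT y:{c..z}|lborel. plateau \<delta> n y)"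
      by (rule set_borel_integral_eq_integral(2)[symmetric])
    also have "\<dots> = plateau_int \<delta> n z"
      unfolding plateau_int_def set_lebesgue_integral_def
    proof (rule Bochner_Integration.integral_cong)
      show "indicat_real {c..z} y *\<^sub>R plateau \<delta> n y = plateau \<delta> n y * indicat_real {..z} y" for y
        by (cases "y \<in> {0<..<\<delta>}") (auto simp: c_def indicator_def plateau_eq_0)
    qed simp
    finally show ?thesis .
  qed
  have "c < x" by (simp add: c_def)
  then show ?thesis
    by (intro has_field_derivative_transform_within_open[OF D, of "{c<..}"]) (simp_all add: eq)
qed

section \<open>Weak derivatives and difference quotients\<close>

text \<open>The trapezoid with edges of width \<open>\<delta>\<close> starting at \<open>c\<close>
  and \<open>d\<close> is only Lipschitz and hence no test function. It is the limit of test
  functions whose derivatives are differences of two plateaus, and dominated convergence carries the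
  identity to the limit.\<close>

lemma weak_derivative_trapezoid:
  assumes wd: "has_weak_derivative a b u v"
    and "a < c" "c < d" "0 < \<delta>" "d + \<delta> < b"
  shows "(LINT t|lebesgue. u t * (indicator {c<..<c+\<delta>} t - indicator {d<..<d+\<delta>} t)) =
    - (LINT t|lebesgue. v t * (max 0 (min (t - c) \<delta>) - max 0 (min (t - d) \<delta>)))"
proof -
  \<comment> \<open>A compact subinterval of the open interval that carries all the test functions
    below; on it local integrability becomes integrability.\<close>
  define I where "I = {c..d+\<delta>}"
  have I: "u absolutely_integrable_on I" "v absolutely_integrable_on I"
    using wd assms by (auto simp: has_weak_derivative_def locally_integrable_def I_def)
  then have int: "integrable lebesgue (\<lambda>t. indicator I t * u t)" "integrable lebesgue (\<lambda>t. indicator I t * v t)"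
    by (auto simp: set_integrable_def)
  note meas [measurable] = borel_measurable_integrable[OF int(1)] borel_measurable_integrable[OF int(2)]
  define \<psi> where "\<psi> n t = plateau \<delta> n (t - c) - plateau \<delta> n (t - d)" for n t
  \<comment> \<open>To the right of \<open>d + \<delta>\<close> both terms have reached the same
    constant, whatever \<open>n\<close> is, so the difference has compact support.\<close>
  define \<phi> where "\<phi> n t = plateau_int \<delta> n (t - c) - plateau_int \<delta> n (t - d)" for n t
  have D: "(\<phi> n has_real_derivative \<psi> n t) (at t)" for n t
    unfolding \<phi>_def[abs_def] \<psi>_def
    by (auto intro!: derivative_eq_intros DERIV_chain2[OF plateau_int_has_derivative])
  have supp: "\<phi> n t = 0" "\<psi> n t = 0" if "t \<notin> I" for n t
  proof -
    consider "t < c" | "t > d + \<delta>" using \<open>t \<notin> I\<close> by (auto simp: I_def)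
    then show "\<phi> n t = 0"
    proof cases
      case 2
      then have "t - c \<ge> \<delta>" "t - d \<ge> \<delta>" using assms by auto
      then show ?thesis
        using plateau_int_eq_const[of \<delta> "t - c" n] plateau_int_eq_const[of \<delta> "t - d" n]
        by (simp add: \<phi>_def)
    qed (use assms in \<open>simp add: \<phi>_def plateau_int_eq_0\<close>)
    have "plateau \<delta> n (t - c) = 0" "plateau \<delta> n (t - d) = 0"
      using that assms by (auto intro!: plateau_eq_0 simp: I_def)
    then show "\<psi> n t = 0" by (simp add: \<psi>_def)
  qed
  have "test_function a b (\<phi> n)" for n
  proof (rule test_function_antiderivative[of "\<psi> n" _ c "d + \<delta>"])
    show "\<psi> n \<in> smooth_algebra"
      unfolding \<psi>_def[abs_def]
      by (intro smooth_algebra_diff smooth_algebra_translate plateau_smooth)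
  qed (use D supp assms I_def in auto)
  moreover have "deriv (\<phi> n) = \<psi> n" for n
    using D by (intro ext DERIV_imp_deriv) auto
  ultimately have *: "(LINT t|lebesgue_on {a..b}. u t * \<psi> n t) = - (LINT t|lebesgue_on {a..b}. v t * \<phi> n t)" for n
    using wd unfolding has_weak_derivative_def by metis
  have Iab: "t \<in> {a..b}" if "t \<in> I" for t using that assms by (auto simp: I_def)
  have meas_test [measurable]: "(\<lambda>t. \<psi> n t) \<in> borel_measurable lebesgue" "(\<lambda>t. \<phi> n t) \<in> borel_measurable lebesgue" for n
  proof -
    have "isCont (\<phi> n) t" for t using D by (rule DERIV_isCont)
    then have "continuous_on UNIV (\<phi> n)" by (simp add: continuous_at_imp_continuous_on)
    then have "\<phi> n \<in> borel_measurable borel" by (rule borel_measurable_continuous_onI)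
    then show "\<phi> n \<in> borel_measurable lebesgue" by (simp add: measurable_completion)
    have "\<psi> n \<in> borel_measurable borel" unfolding \<psi>_def by measurable
    then show "\<psi> n \<in> borel_measurable lebesgue" by (simp add: measurable_completion)
  qed
  have lhs: "(LINT t|lebesgue_on {a..b}. u t * \<psi> n t) = (LINT t|lebesgue. (indicator I t * u t) * \<psi> n t)" for n
    by (subst integral_restrict_space) (use supp Iab in \<open>auto intro!: Bochner_Integration.integral_cong simp: indicator_def\<close>)
  have rhs: "(LINT t|lebesgue_on {a..b}. v t * \<phi> n t) = (LINT t|lebesgue. (indicator I t * v t) * \<phi> n t)" for n
    by (subst integral_restrict_space) (use supp Iab in \<open>auto intro!: Bochner_Integration.integral_cong simp: indicator_def\<close>)
  have ind_shift: "indicator {0<..<\<delta>} (t - e) = (indicator {e<..<e+\<delta>} t :: real)" for t e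
    by (auto simp: indicator_def)
  have "(\<lambda>n. LINT t|lebesgue. (indicator I t * u t) * \<psi> n t) \<longlonglongrightarrow>
      (LINT t|lebesgue. (indicator I t * u t) * (indicator {c<..<c+\<delta>} t - indicator {d<..<d+\<delta>} t))"
  proof (rule integral_dominated_convergence[where w="\<lambda>t. \<bar>indicator I t * u t\<bar>"])
    show "AE t in lebesgue. (\<lambda>n. indicator I t * u t * \<psi> n t) \<longlonglongrightarrow>
        indicator I t * u t * (indicator {c<..<c+\<delta>} t - indicator {d<..<d+\<delta>} t)"
      unfolding \<psi>_def ind_shift[symmetric]
      by (intro always_eventually allI tendsto_intros plateau_tendsto)
    have "\<bar>\<psi> n t\<bar> \<le> 1" for n t
      using plateau_nonneg[of \<delta> n "t - c"] plateau_nonneg[of \<delta> n "t - d"]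
        plateau_le_1[of \<delta> n "t - c"] plateau_le_1[of \<delta> n "t - d"]
      by (simp add: \<psi>_def)
    then show "AE t in lebesgue. norm (indicator I t * u t * \<psi> n t) \<le> \<bar>indicator I t * u t\<bar>" for n
      by (simp add: abs_mult mult_left_le)
    show "(\<lambda>t. indicator I t * u t * (indicator {c<..<c+\<delta>} t - indicator {d<..<d+\<delta>} t)) \<in> borel_measurable lebesgue"
      by (rule borel_measurable_times[OF meas(1)]) (auto intro!: borel_measurable_diff borel_measurable_indicator)
  qed (use int meas in auto)
  moreover have "(\<lambda>n. LINT t|lebesgue. (indicator I t * v t) * \<phi> n t) \<longlonglongrightarrow>
      (LINT t|lebesgue. (indicator I t * v t) * (max 0 (min (t - c) \<delta>) - max 0 (min (t - d) \<delta>)))"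
  proof (rule integral_dominated_convergence[where w="\<lambda>t. \<bar>indicator I t * v t\<bar> * \<delta>"])
    show "AE t in lebesgue. (\<lambda>n. indicator I t * v t * \<phi> n t) \<longlonglongrightarrow>
        indicator I t * v t * (max 0 (min (t - c) \<delta>) - max 0 (min (t - d) \<delta>))"
      unfolding \<phi>_def
      by (intro always_eventually allI tendsto_intros plateau_int_tendsto assms)
    have "\<bar>\<phi> n t\<bar> \<le> \<delta>" for n t
      using plateau_int_bounds[OF \<open>0 < \<delta>\<close>, of n "t - c"] plateau_int_bounds[OF \<open>0 < \<delta>\<close>, of n "t - d"]
      by (simp add: \<phi>_def)
    then show "AE t in lebesgue. norm (indicator I t * v t * \<phi> n t) \<le> \<bar>indicator I t * v t\<bar> * \<delta>" for n
      by (simp add: abs_mult mult_left_mono)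
    show "(\<lambda>t. indicator I t * v t * (max 0 (min (t - c) \<delta>) - max 0 (min (t - d) \<delta>))) \<in> borel_measurable lebesgue"
      by (rule borel_measurable_times[OF meas(2)]) (auto intro!: measurable_completion)
  qed (use int meas in auto)
  from tendsto_minus[OF this] LIMSEQ_unique calculation have "(LINT t|lebesgue. (indicator I t * u t) * (indicator {c<..<c+\<delta>} t - indicator {d<..<d+\<delta>} t))
      = - (LINT t|lebesgue. (indicator I t * v t) * (max 0 (min (t - c) \<delta>) - max 0 (min (t - d) \<delta>)))"
    using * unfolding lhs rhs by (simp only:) (blast intro: LIMSEQ_unique)
  moreover have "(indicator I t * u t) * (indicator {c<..<c+\<delta>} t - indicator {d<..<d+\<delta>} t) =
      u t * (indicator {c<..<c+\<delta>} t - indicator {d<..<d+\<delta>} t)" for t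
    using assms by (auto simp: I_def indicator_def)
  moreover have "(indicator I t * v t) * (max 0 (min (t - c) \<delta>) - max 0 (min (t - d) \<delta>)) =
      v t * (max 0 (min (t - c) \<delta>) - max 0 (min (t - d) \<delta>))" for t
    using assms by (auto simp: I_def indicator_def max_def min_def)
  ultimately show ?thesis by (simp only:)
qed

text \<open>Lebesgue's differentiation theorem for one-sided averages, applied to truncations to
  compact intervals that exhaust (a, b); the countably many exceptional sets have a null
  union.\<close>

lemma lebesgue_points_right:
  assumes "locally_integrable a b u"
  obtains N where "negligible N"
    "\<And>x. x \<in> {a<..<b} \<Longrightarrow> x \<notin> N \<Longrightarrow> ((\<lambda>h. integral {x..x+h} u / h) \<longlongrightarrow> u x) (at_right 0)"
proof -
  define c d where "c m = a + 1 / (real m + 1)" and "d m = b - 1 / (real m + 1)" for m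
  define U where "U m = (\<lambda>x. if x \<in> {c m..d m} then u x else 0)" for m
  have "u absolutely_integrable_on {c m..d m}" for m
    using assms by (auto simp: locally_integrable_def c_def d_def)
  then have "U m absolutely_integrable_on UNIV" for m
    by (simp only: U_def absolutely_integrable_restrict_UNIV)
  then have "U m integrable_on cbox x y" for m x y
    by (meson absolutely_integrable_on_def integrable_on_subcbox top_greatest)
  then have "\<exists>N. negligible N \<and> (\<forall>x e. x \<notin> N \<longrightarrow> 0 < e \<longrightarrow> (\<exists>\<delta>>0. \<forall>h. 0 < h \<and> h < \<delta> \<longrightarrow>
      norm (integral (cbox x (x + h *\<^sub>R One)) (U m) /\<^sub>R h ^ DIM(real) - U m x) < e))" for m
    by (rule integrable_ccontinuous_explicit) blast
  then obtain N where N: "\<And>m. negligible (N m)"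
    "\<And>m x e. x \<notin> N m \<Longrightarrow> 0 < e \<Longrightarrow> \<exists>\<delta>>0. \<forall>h. 0 < h \<and> h < \<delta> \<longrightarrow>
      norm (integral (cbox x (x + h *\<^sub>R One)) (U m) /\<^sub>R h ^ DIM(real) - U m x) < e"
    by metis
  show thesis
  proof
    show "negligible (\<Union>m. N m)" by (rule negligible_countable_Union) (use N in auto)
    fix x assume x: "x \<in> {a<..<b}" "x \<notin> (\<Union>m. N m)"
    obtain m where "inverse (real (Suc m)) < min (x - a) (b - x)"
      using reals_Archimedean[of "min (x - a) (b - x)"] x by auto
    then have m: "c m < x" "x < d m"
      by (auto simp: c_def d_def inverse_eq_divide add.commute)
    have "((\<lambda>h. integral {x..x+h} (U m) / h) \<longlongrightarrow> U m x) (at_right 0)"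
      unfolding tendsto_iff eventually_at_right_field dist_real_def
      using N(2)[of x m] x(2) by (force simp: divide_inverse mult.commute)
    moreover have "\<forall>\<^sub>F h in at_right 0. integral {x..x+h} (U m) / h = integral {x..x+h} u / h"
      unfolding eventually_at_right_field
    proof (intro exI[of _ "d m - x"] conjI allI impI)
      fix h assume "h > 0" "h < d m - x"
      then have "integral {x..x+h} (U m) = integral {x..x+h} u"
        by (intro integral_cong) (use m in \<open>auto simp: U_def\<close>)
      then show "integral {x..x+h} (U m) / h = integral {x..x+h} u / h" by simp
    qed (use m in auto)
    ultimately have "((\<lambda>h. integral {x..x+h} u / h) \<longlongrightarrow> U m x) (at_right 0)"
      by (rule Lim_transform_eventually)
    then show "((\<lambda>h. integral {x..x+h} u / h) \<longlongrightarrow> u x) (at_right 0)"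
      using m by (simp add: U_def)
  qed
qed

lemma clamp_quotient_tendsto:
  fixes x \<epsilon> :: real
  assumes "0 < \<epsilon>"
  shows "(\<lambda>n. max 0 (min x (\<epsilon> / real (Suc n))) / (\<epsilon> / real (Suc n))) \<longlonglongrightarrow> indicator {0<..} x"
proof (cases "x > 0")
  case True
  have "(\<lambda>n. \<epsilon> / real (Suc n)) \<longlonglongrightarrow> 0"
    by (rule tendsto_divide_0[OF tendsto_const]) (rule filterlim_compose[OF filterlim_at_top_imp_at_infinity[OF filterlim_real_sequentially] filterlim_Suc])
  then have "\<forall>\<^sub>F n in sequentially. \<epsilon> / real (Suc n) < x"
    using True by (rule order_tendstoD)
  then have "\<forall>\<^sub>F n in sequentially. 1 = max 0 (min x (\<epsilon> / real (Suc n))) / (\<epsilon> / real (Suc n))"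
    by eventually_elim (use True assms in \<open>auto simp: min_def max_def\<close>)
  then have "(\<lambda>n. max 0 (min x (\<epsilon> / real (Suc n))) / (\<epsilon> / real (Suc n))) \<longlonglongrightarrow> 1"
    by (rule Lim_transform_eventually[OF tendsto_const])
  then show ?thesis using True by simp
next
  case False
  then have "max 0 (min x (\<epsilon> / real (Suc n))) = 0" for n
    by auto
  then show ?thesis using False by simp
qed

text \<open>The edges of the trapezoid shrink to zero width: the averages of \<open>u\<close> to the
  right of \<open>c\<close> and \<open>d\<close> tend to \<open>u c\<close> and \<open>u d\<close>,
  and the normalised trapezoid tends to the indicator of (c, d]. The exceptional set consists of the
  points where the right averages of \<open>u\<close> misbehave, so it does not depend on
  \<open>c\<close> and \<open>d\<close>.\<close>

lemma weak_derivative_eq_integral: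
  assumes wd: "has_weak_derivative a b u v"
  obtains N where "negligible N"
    "\<And>c d. a < c \<Longrightarrow> c < d \<Longrightarrow> d < b \<Longrightarrow> c \<notin> N \<Longrightarrow> d \<notin> N \<Longrightarrow> u d - u c = integral {c..d} v"
proof -
  have "locally_integrable a b u" using wd by (simp add: has_weak_derivative_def)
  then obtain N where N: "negligible N"
    "\<And>x. x \<in> {a<..<b} \<Longrightarrow> x \<notin> N \<Longrightarrow> ((\<lambda>h. integral {x..x+h} u / h) \<longlongrightarrow> u x) (at_right 0)"
    using lebesgue_points_right by blast
  have "u d - u c = integral {c..d} v"
    if "a < c" "c < d" "d < b" "c \<notin> N" "d \<notin> N" for c d
  proof -
    \<comment> \<open>Half the distance to \<open>b\<close> keeps the right edge of every trapezoid
      inside the open interval.\<close>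
    define \<epsilon> where "\<epsilon> = (b - d) / 2"
    define \<delta> where "\<delta> n = \<epsilon> / real (Suc n)" for n
    have \<epsilon>: "0 < \<epsilon>" using that by (simp add: \<epsilon>_def)
    then have \<delta>: "0 < \<delta> n" "\<delta> n \<le> \<epsilon>" for n by (auto simp: \<delta>_def field_simps)
    have b: "d + \<delta> n < b" "c + \<delta> n < b" for n using \<delta>(2)[of n] that by (auto simp: \<epsilon>_def field_simps)
    define I where "I = {c..d+\<epsilon>}"
    have "u absolutely_integrable_on I" "v absolutely_integrable_on I"
      using wd that by (auto simp: has_weak_derivative_def locally_integrable_def I_def \<epsilon>_def field_simps)
    then have int: "integrable lebesgue (\<lambda>t. indicator I t * u t)" "integrable lebesgue (\<lambda>t. indicator I t * v t)"
      by (auto simp: set_integrable_def)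
    define T where "T n t = (max 0 (min (t - c) (\<delta> n)) - max 0 (min (t - d) (\<delta> n))) / \<delta> n" for n t
    have u_int: "u absolutely_integrable_on {e..e+\<delta> n}" if "a < e" "e + \<delta> n < b" for e n
      using wd that by (auto simp: has_weak_derivative_def locally_integrable_def)
    have u_eq: "(LINT t|lebesgue. u t * indicator {e<..<e+\<delta> n} t) = integral {e..e+\<delta> n} u"
      "integrable lebesgue (\<lambda>t. u t * indicator {e<..<e+\<delta> n} t)"
      if "a < e" "e + \<delta> n < b" for e n
    proof -
      have *: "u absolutely_integrable_on {e<..<e+\<delta> n}"
        using u_int[OF that] by (simp add: absolutely_integrable_on_Icc_iff_Ioo)
      then show "integrable lebesgue (\<lambda>t. u t * indicator {e<..<e+\<delta> n} t)"
        by (simp add: set_integrable_def mult.commute)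
      have "(LINT t|lebesgue. u t * indicator {e<..<e+\<delta> n} t) = integral {e<..<e+\<delta> n} u"
        using set_lebesgue_integral_eq_integral(2)[OF *] by (simp add: set_lebesgue_integral_def mult.commute)
      then show "(LINT t|lebesgue. u t * indicator {e<..<e+\<delta> n} t) = integral {e..e+\<delta> n} u"
        by (simp add: integral_open_interval_real)
    qed
    have eq: "integral {c..c+\<delta> n} u / \<delta> n - integral {d..d+\<delta> n} u / \<delta> n =
        - (LINT t|lebesgue. (indicator I t * v t) * T n t)" for n
    proof -
      have "integral {c..c+\<delta> n} u - integral {d..d+\<delta> n} u =
          (LINT t|lebesgue. u t * indicator {c<..<c+\<delta> n} t) - (LINT t|lebesgue. u t * indicator {d<..<d+\<delta> n} t)"
        using u_eq(1) b that by simp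
      also have "\<dots> = (LINT t|lebesgue. u t * (indicator {c<..<c+\<delta> n} t - indicator {d<..<d+\<delta> n} t))"
        using u_eq(2)[of c n] u_eq(2)[of d n] b that by (simp add: right_diff_distrib)
      also have "\<dots> = - (LINT t|lebesgue. v t * (max 0 (min (t - c) (\<delta> n)) - max 0 (min (t - d) (\<delta> n))))"
        by (rule weak_derivative_trapezoid[OF wd]) (use that \<delta> b in auto)
      also have "(\<lambda>t. v t * (max 0 (min (t - c) (\<delta> n)) - max 0 (min (t - d) (\<delta> n)))) =
          (\<lambda>t. \<delta> n * ((indicator I t * v t) * T n t))"
        using \<delta>[of n] that by (intro ext) (auto simp: T_def I_def indicator_def max_def min_def)
      finally show ?thesis
        using \<delta>(1)[of n] by (simp add: field_simps)
    qed
    have \<delta>_right: "filterlim \<delta> (at_right 0) sequentially"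
    proof -
      have "\<delta> \<longlonglongrightarrow> 0"
        unfolding \<delta>_def
        by (rule tendsto_divide_0[OF tendsto_const]) (rule filterlim_compose[OF filterlim_at_top_imp_at_infinity[OF filterlim_real_sequentially] filterlim_Suc])
      then show ?thesis using \<delta>(1) by (simp add: tendsto_imp_filterlim_at_right)
    qed
    have "(\<lambda>n. integral {c..c+\<delta> n} u / \<delta> n - integral {d..d+\<delta> n} u / \<delta> n) \<longlonglongrightarrow> u c - u d"
      using that by (intro tendsto_diff filterlim_compose[OF N(2) \<delta>_right]) auto
    moreover have "(\<lambda>n. - (LINT t|lebesgue. (indicator I t * v t) * T n t)) \<longlonglongrightarrow>
        - (LINT t|lebesgue. (indicator I t * v t) * (indicator {0<..} (t - c) - indicator {0<..} (t - d)))"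
    proof (intro tendsto_minus integral_dominated_convergence[where w="\<lambda>t. \<bar>indicator I t * v t\<bar>"])
      show "AE t in lebesgue. (\<lambda>n. indicator I t * v t * T n t) \<longlonglongrightarrow>
          indicator I t * v t * (indicator {0<..} (t - c) - indicator {0<..} (t - d))"
        unfolding T_def \<delta>_def diff_divide_distrib
        by (intro always_eventually allI tendsto_mult tendsto_diff tendsto_const clamp_quotient_tendsto \<epsilon>)
      have "\<bar>T n t\<bar> \<le> 1" for n t
        using \<delta>(1)[of n] \<open>c < d\<close> by (auto simp: T_def max_def min_def field_simps)
      then show "AE t in lebesgue. norm (indicator I t * v t * T n t) \<le> \<bar>indicator I t * v t\<bar>" for n
        by (simp add: abs_mult mult_left_le)
      show "(\<lambda>t. indicator I t * v t * T n t) \<in> borel_measurable lebesgue" for n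
        by (rule borel_measurable_times[OF borel_measurable_integrable[OF int(2)]])
          (auto intro!: measurable_completion simp: T_def[abs_def])
      show "(\<lambda>t. indicator I t * v t * (indicator {0<..} (t - c) - indicator {0<..} (t - d))) \<in> borel_measurable lebesgue"
        by (rule borel_measurable_times[OF borel_measurable_integrable[OF int(2)]])
          (auto intro!: measurable_completion)
    qed (use int in auto)
    ultimately have "u c - u d = - (LINT t|lebesgue. (indicator I t * v t) * (indicator {0<..} (t - c) - indicator {0<..} (t - d)))"
      unfolding eq by (rule LIMSEQ_unique)
    also have "(\<lambda>t. (indicator I t * v t) * (indicator {0<..} (t - c) - indicator {0<..} (t - d))) =
        (\<lambda>t. indicator {c<..d} t *\<^sub>R v t)"
      using that \<epsilon> by (intro ext) (auto simp: I_def indicator_def)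
    also have "(LINT t|lebesgue. indicator {c<..d} t *\<^sub>R v t) = integral {c<..d} v"
    proof -
      have "v absolutely_integrable_on {c..d}"
        using wd that by (auto simp: has_weak_derivative_def locally_integrable_def)
      then have "v absolutely_integrable_on {c<..d}"
        by (rule set_integrable_subset) auto
      from set_lebesgue_integral_eq_integral(2)[OF this] show ?thesis
        by (simp add: set_lebesgue_integral_def)
    qed
    also have "integral {c<..d} v = integral {c..d} v"
      by (rule integral_subset_negligible) (auto intro: negligible_subset[of "{c}"])
    finally show ?thesis by simp
  qed
  with N(1) show thesis by (rule that)
qed

lemma negligible_vimage_translation: "negligible ((\<lambda>x. x + c) -` N)" if "negligible N" for c :: real
proof -
  have "(\<lambda>x. x + c) -` N = (\<lambda>x. -c + x) ` N"
    by (force simp: image_iff)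
  then show ?thesis using negligible_translation[OF that, of "-c"] by simp
qed

text \<open>Since \<open>u\<close> is not replaced by its continuous representative, its increments
  are controlled only off a null set. Restricting the increments to a sequence makes the union of
  the shifted null sets countable and hence null.\<close>

lemma weak_derivative_difference_quotient:
  assumes wd: "has_weak_derivative a b u v"
  shows "AE t in lebesgue. t \<in> {a<..<b} \<longrightarrow>
    (\<lambda>n. (u (t + 1 / real (Suc n)) - u t) * real (Suc n)) \<longlonglongrightarrow> v t"
proof -
  obtain N where N: "negligible N"
    "\<And>c d. a < c \<Longrightarrow> c < d \<Longrightarrow> d < b \<Longrightarrow> c \<notin> N \<Longrightarrow> d \<notin> N \<Longrightarrow> u d - u c = integral {c..d} v"
    using weak_derivative_eq_integral[OF wd] by blast
  have "locally_integrable a b v" using wd by (simp add: has_weak_derivative_def)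
  then obtain M where M: "negligible M"
    "\<And>x. x \<in> {a<..<b} \<Longrightarrow> x \<notin> M \<Longrightarrow> ((\<lambda>h. integral {x..x+h} v / h) \<longlongrightarrow> v x) (at_right 0)"
    using lebesgue_points_right by blast
  let ?N = "N \<union> M \<union> (\<Union>n. (\<lambda>x. x + 1 / real (Suc n)) -` N)"
  have inv0: "(\<lambda>n. 1 / real (Suc n)) \<longlonglongrightarrow> 0"
    using LIMSEQ_inverse_real_of_nat by (simp add: inverse_eq_divide)
  have "negligible ?N"
    using N(1) M(1) by (intro negligible_Un negligible_countable_Union) (auto intro: negligible_vimage_translation)
  then have "AE t in lebesgue. t \<notin> ?N"
    by (intro AE_not_in) (simp add: negligible_iff_null_sets)
  then show ?thesis
  proof eventually_elim
    case (elim t)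
    show ?case
    proof
      assume t: "t \<in> {a<..<b}"
      have "(\<lambda>n. integral {t..t + 1 / real (Suc n)} v / (1 / real (Suc n))) \<longlonglongrightarrow> v t"
        using M(2)[OF t] elim inv0
        by (intro filterlim_compose[OF M(2)[OF t]] tendsto_imp_filterlim_at_right) auto
      moreover have "\<forall>\<^sub>F n in sequentially. 1 / real (Suc n) < b - t"
        using order_tendstoD(2)[OF inv0] t by auto
      then have "\<forall>\<^sub>F n in sequentially. integral {t..t + 1 / real (Suc n)} v / (1 / real (Suc n)) =
          (u (t + 1 / real (Suc n)) - u t) * real (Suc n)"
        by eventually_elim (subst N(2), use t elim in auto)
      ultimately show "(\<lambda>n. (u (t + 1 / real (Suc n)) - u t) * real (Suc n)) \<longlonglongrightarrow> v t"
        by (rule Lim_transform_eventually)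
    qed
  qed
qed

section \<open>Abel kernels\<close>

lemma gker_measurable [measurable]: "gker \<beta> \<in> borel_measurable borel"
  unfolding gker_def[abs_def] by measurable

lemma gker_nonneg: "0 < \<beta> \<Longrightarrow> 0 \<le> gker \<beta> x"
  by (simp add: gker_def Gamma_real_nonneg)

lemma gker_1: "gker 1 x = indicator {0<..} x"
  by (simp add: gker_def Gamma_1 indicator_def)

section \<open>The semigroup law of the Abel kernels\<close>

lemma has_bochner_integral_Beta:
  assumes "0 < \<alpha>" "0 < (\<beta>::real)"
  shows "has_bochner_integral lborel
    (\<lambda>t. indicator {0<..<1} t * (t powr (\<alpha> - 1) * (1 - t) powr (\<beta> - 1))) (Beta \<alpha> \<beta>)"
proof -
  let ?f = "\<lambda>t::real. t powr (\<alpha> - 1) * (1 - t) powr (\<beta> - 1)"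
  have *: "(?f has_integral Beta \<alpha> \<beta>) {0<..<1}"
    using has_integral_Beta_real[OF assms] by (simp add: has_integral_Icc_iff_Ioo)
  then have ai: "?f absolutely_integrable_on {0<..<1}"
    by (intro nonnegative_absolutely_integrable_1) auto
  have eq: "(LINT t:{0<..<1}|lebesgue. ?f t) = Beta \<alpha> \<beta>"
    using set_lebesgue_integral_eq_integral(2)[OF ai] * by (simp add: integral_unique)
  have m: "(\<lambda>t. indicator {0<..<1} t * ?f t) \<in> borel_measurable lborel" by measurable
  show ?thesis
    using ai eq integrable_completion[OF m] integral_completion[OF m]
    by (simp add: has_bochner_integral_iff set_integrable_def set_lebesgue_integral_def)
qed

text \<open>The substitution y = x t turns the integral over (0, x) into a Beta integral, and the
  Gamma factors in the Beta function are absorbed by the normalisation of the kernels.\<close>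

lemma gker_convolution:
  assumes "0 < \<alpha>" "0 < \<beta>"
  shows "has_bochner_integral lborel (\<lambda>y. gker \<alpha> (x - y) * gker \<beta> y) (gker (\<alpha> + \<beta>) x)"
proof (cases "x > 0")
  case False
  then have "(\<lambda>y. gker \<alpha> (x - y) * gker \<beta> y) = (\<lambda>y. 0)" "gker (\<alpha> + \<beta>) x = 0"
    by (auto simp: gker_def)
  then show ?thesis by (simp add: has_bochner_integral_zero)
next
  case True
  let ?C = "x powr (\<alpha> + \<beta> - 2) / (Gamma \<alpha> * Gamma \<beta>)"
  have eq: "gker \<alpha> (x - (0 + x * t)) * gker \<beta> (0 + x * t) =
      ?C * (indicator {0<..<1} t * (t powr (\<beta> - 1) * (1 - t) powr (\<alpha> - 1)))" for t
  proof (cases "0 < t \<and> t < 1")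
    case t: True
    have "(x - x * t) powr (\<alpha> - 1) = x powr (\<alpha> - 1) * (1 - t) powr (\<alpha> - 1)"
      using powr_mult[of x "1 - t" "\<alpha> - 1"] t True by (simp add: algebra_simps)
    moreover have "(x * t) powr (\<beta> - 1) = x powr (\<beta> - 1) * t powr (\<beta> - 1)"
      using t True by (simp add: powr_mult)
    moreover have "x powr (\<alpha> - 1) * x powr (\<beta> - 1) = x powr (\<alpha> + \<beta> - 2)"
      by (simp add: powr_add[symmetric] algebra_simps)
    moreover have "x * t < x" "0 < x * t" using t True by auto
    ultimately show ?thesis
      using t by (simp add: gker_def field_simps)
  next
    case t: False
    then have "\<not> (0 < x * t \<and> x * t < x)" using True by (auto simp: zero_less_mult_iff)
    then show ?thesis using t by (auto simp: gker_def indicator_def)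
  qed
  have "has_bochner_integral lborel (\<lambda>t. gker \<alpha> (x - (0 + x * t)) * gker \<beta> (0 + x * t)) (?C * Beta \<beta> \<alpha>)"
    unfolding eq by (intro has_bochner_integral_mult_right has_bochner_integral_Beta assms)
  \<comment> \<open>The division by the absolute value of \<open>x\<close> accounts for the Jacobian
    of the substitution.\<close>
  also have "?C * Beta \<beta> \<alpha> = gker (\<alpha> + \<beta>) x / \<bar>x\<bar>"
  proof -
    have "Gamma \<alpha> \<noteq> 0" "Gamma \<beta> \<noteq> 0" using assms by (simp_all add: Gamma_real_pos less_imp_neq[symmetric])
    moreover have "x powr (\<alpha> + \<beta> - 1) = x powr (\<alpha> + \<beta> - 2) * x"
      using powr_add[of x "\<alpha> + \<beta> - 2" 1] True by simp
    ultimately show ?thesis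
      using True by (simp add: gker_def Beta_def field_simps)
  qed
  finally show ?thesis
    using lborel_has_bochner_integral_real_affine_iff[of x "\<lambda>y. gker \<alpha> (x - y) * gker \<beta> y" "gker (\<alpha> + \<beta>) x" 0] True
    by (simp add: divide_inverse mult.commute)
qed

lemma gker_antimono:
  assumes "0 < \<beta>" "\<beta> \<le> 1" "0 < x" "x \<le> y"
  shows "gker \<beta> y \<le> gker \<beta> x"
  using assms by (auto simp: gker_def intro!: divide_right_mono powr_mono2' Gamma_real_nonneg)

lemma gker_mono:
  assumes "1 \<le> \<beta>" "x \<le> y"
  shows "gker \<beta> x \<le> gker \<beta> y"
  using assms by (auto simp: gker_def intro!: divide_right_mono powr_mono2 Gamma_real_nonneg)

text \<open>Fubini's theorem for the double integral. As \<open>p\<close> and \<open>q\<close> are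
  nonnegative, integrating the absolute value over \<open>s\<close> first gives
  \<open>w (t - r)\<close> times |u r|, so integrability against \<open>w\<close> suffices. The
  third claim yields the existence almost everywhere of convolutions with singular kernels.\<close>

lemma convolution_assoc_lborel:
  fixes p q w u :: "real \<Rightarrow> real"
  assumes [measurable]: "p \<in> borel_measurable borel" "q \<in> borel_measurable borel" "u \<in> borel_measurable borel"
    and nonneg: "\<And>x. 0 \<le> p x" "\<And>x. 0 \<le> q x"
    and pq: "\<And>x. has_bochner_integral lborel (\<lambda>y. p (x - y) * q y) (w x)"
    and wu: "integrable lborel (\<lambda>r. w (t - r) * u r)"
  shows "integrable lborel (\<lambda>s. p (t - s) * (LINT r|lborel. q (s - r) * u r))"
    and "(LINT s|lborel. p (t - s) * (LINT r|lborel. q (s - r) * u r)) = (LINT r|lborel. w (t - r) * u r)"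
    and "AE s in lborel. p (t - s) \<noteq> 0 \<longrightarrow> integrable lborel (\<lambda>r. q (s - r) * u r)"
proof -
  define H where "H = (\<lambda>(s, r). p (t - s) * (q (s - r) * u r))"
  have H [measurable]: "H \<in> borel_measurable (lborel \<Otimes>\<^sub>M lborel)" unfolding H_def by measurable
  have inner: "has_bochner_integral lborel (\<lambda>s. p (t - s) * (q (s - r) * c)) (w (t - r) * c)" for r c
  proof -
    have "has_bochner_integral lborel (\<lambda>y. p ((t - r) - y) * q y * c) (w (t - r) * c)"
      by (intro has_bochner_integral_mult_left pq)
    then show ?thesis
      using lborel_has_bochner_integral_real_affine_iff[of 1 "\<lambda>s. p (t - s) * (q (s - r) * c)" "w (t - r) * c" r]
      by (simp add: algebra_simps)
  qed
  have w_nonneg: "0 \<le> w x" for x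
    using pq[of x] integral_nonneg_AE[of "\<lambda>y. p (x - y) * q y" lborel] nonneg
    by (simp add: has_bochner_integral_iff)
  have "(\<integral>\<^sup>+z. ennreal (norm (H z)) \<partial>(lborel \<Otimes>\<^sub>M lborel)) = (\<integral>\<^sup>+r. \<integral>\<^sup>+s. ennreal (norm (H (s, r))) \<partial>lborel \<partial>lborel)"
    by (rule lborel_pair.nn_integral_snd[symmetric]) measurable
  also have "\<dots> = (\<integral>\<^sup>+r. ennreal (norm (w (t - r) * u r)) \<partial>lborel)"
  proof (rule nn_integral_cong)
    fix r
    have "(\<integral>\<^sup>+s. ennreal (p (t - s) * (q (s - r) * \<bar>u r\<bar>)) \<partial>lborel) = ennreal (w (t - r) * \<bar>u r\<bar>)"
      using inner[of r "\<bar>u r\<bar>"] nonneg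
      by (subst nn_integral_eq_integral) (auto simp: has_bochner_integral_iff)
    then show "(\<integral>\<^sup>+s. ennreal (norm (H (s, r))) \<partial>lborel) = ennreal (norm (w (t - r) * u r))"
      using nonneg w_nonneg by (simp add: H_def abs_mult)
  qed
  also have "\<dots> < \<infinity>" using wu by (simp add: integrable_iff_bounded)
  finally have int: "integrable (lborel \<Otimes>\<^sub>M lborel) H" by (intro integrableI_bounded H)
  have "integrable lborel (\<lambda>s. LINT r|lborel. H (s, r))"
    by (rule lborel_pair.integrable_fst'[OF int])
  then show "integrable lborel (\<lambda>s. p (t - s) * (LINT r|lborel. q (s - r) * u r))"
    by (simp add: H_def)
  have "AE s in lborel. integrable lborel (\<lambda>r. H (s, r))"
    by (rule lborel_pair.AE_integrable_fst'[OF int])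
  then show "AE s in lborel. p (t - s) \<noteq> 0 \<longrightarrow> integrable lborel (\<lambda>r. q (s - r) * u r)"
    by (rule AE_mp) (auto simp: H_def)
  have "(LINT s|lborel. LINT r|lborel. H (s, r)) = (LINT r|lborel. LINT s|lborel. H (s, r))"
    using lborel_pair.Fubini_integral[of "\<lambda>s r. H (s, r)"] int by simp
  then show "(LINT s|lborel. p (t - s) * (LINT r|lborel. q (s - r) * u r)) = (LINT r|lborel. w (t - r) * u r)"
    using inner by (simp add: H_def has_bochner_integral_iff)
qed

text \<open>\<open>D\<close> is split into two square roots; Cauchy-Schwarz gives a bound for each
  \<open>t\<close>, which Tonelli's theorem and translation invariance integrate over
  \<open>t\<close>. Values in \<open>ennreal\<close> avoid integrability side conditions.\<close>

lemma Young_L1_L2: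
  fixes D :: "real \<Rightarrow> real" and v :: "real \<Rightarrow> ennreal"
  assumes [measurable]: "D \<in> borel_measurable borel" "v \<in> borel_measurable borel"
    and nonneg: "\<And>x. 0 \<le> D x"
  shows "(\<integral>\<^sup>+t. (\<integral>\<^sup>+r. D (t - r) * v r \<partial>lborel)\<^sup>2 \<partial>lborel) \<le>
    (\<integral>\<^sup>+x. D x \<partial>lborel)\<^sup>2 * (\<integral>\<^sup>+r. (v r)\<^sup>2 \<partial>lborel)"
proof -
  have sq: "ennreal (sqrt (D x)) * ennreal (sqrt (D x)) = ennreal (D x)" for x
    using nonneg by (simp flip: ennreal_mult)
  have shift: "(\<integral>\<^sup>+r. ennreal (D (t - r)) \<partial>lborel) = (\<integral>\<^sup>+x. ennreal (D x) \<partial>lborel)" for t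
    using nn_integral_real_affine[of "\<lambda>x. ennreal (D x)" "-1" t] by simp
  have shift': "(\<integral>\<^sup>+t. ennreal (D (t - r)) \<partial>lborel) = (\<integral>\<^sup>+x. ennreal (D x) \<partial>lborel)" for r
    using nn_integral_real_affine[of "\<lambda>x. ennreal (D x)" 1 "-r"] by simp
  have "(\<integral>\<^sup>+r. D (t - r) * v r \<partial>lborel)\<^sup>2 \<le> (\<integral>\<^sup>+x. D x \<partial>lborel) * (\<integral>\<^sup>+r. D (t - r) * (v r)\<^sup>2 \<partial>lborel)" for t
  proof -
    have "(\<integral>\<^sup>+r. D (t - r) * v r \<partial>lborel)\<^sup>2 =
        (\<integral>\<^sup>+r. ennreal (sqrt (D (t - r))) * (ennreal (sqrt (D (t - r))) * v r) \<partial>lborel)\<^sup>2"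
      by (simp add: mult.assoc[symmetric] sq)
    also have "\<dots> \<le> (\<integral>\<^sup>+r. (ennreal (sqrt (D (t - r))))\<^sup>2 \<partial>lborel) * (\<integral>\<^sup>+r. (ennreal (sqrt (D (t - r))) * v r)\<^sup>2 \<partial>lborel)"
      by (rule Cauchy_Schwarz_nn_integral) measurable
    also have "\<dots> = (\<integral>\<^sup>+x. D x \<partial>lborel) * (\<integral>\<^sup>+r. D (t - r) * (v r)\<^sup>2 \<partial>lborel)"
      by (simp add: power_mult_distrib power2_eq_square[of "ennreal _"] sq shift)
    finally show ?thesis .
  qed
  then have "(\<integral>\<^sup>+t. (\<integral>\<^sup>+r. D (t - r) * v r \<partial>lborel)\<^sup>2 \<partial>lborel) \<le>
      (\<integral>\<^sup>+t. (\<integral>\<^sup>+x. D x \<partial>lborel) * (\<integral>\<^sup>+r. D (t - r) * (v r)\<^sup>2 \<partial>lborel) \<partial>lborel)"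
    by (intro nn_integral_mono)
  also have "\<dots> = (\<integral>\<^sup>+x. D x \<partial>lborel) * (\<integral>\<^sup>+t. \<integral>\<^sup>+r. D (t - r) * (v r)\<^sup>2 \<partial>lborel \<partial>lborel)"
    by (rule nn_integral_cmult) measurable
  also have "(\<integral>\<^sup>+t. \<integral>\<^sup>+r. D (t - r) * (v r)\<^sup>2 \<partial>lborel \<partial>lborel) = (\<integral>\<^sup>+r. \<integral>\<^sup>+t. D (t - r) * (v r)\<^sup>2 \<partial>lborel \<partial>lborel)"
    by (rule lborel_pair.Fubini') measurable
  also have "\<dots> = (\<integral>\<^sup>+x. D x \<partial>lborel) * (\<integral>\<^sup>+r. (v r)\<^sup>2 \<partial>lborel)"
    by (simp add: nn_integral_multc shift' nn_integral_cmult)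
  finally show ?thesis by (simp add: power2_eq_square mult.assoc)
qed

section \<open>Inversion of the Abel integral\<close>

lemma gker_1_diff: "gker 1 (t - r) = indicator {..<t} r"
  by (simp add: gker_1 indicator_def)

text \<open>From order 1 on the kernel is nondecreasing, so where \<open>v\<close> is supported it
  is at most its value at \<open>t - a\<close>.\<close>

lemma integrable_gker_mult:
  assumes "1 \<le> \<beta>" "integrable lborel v" "\<And>r. r < a \<Longrightarrow> v r = 0"
  shows "integrable lborel (\<lambda>r. gker \<beta> (t - r) * v r)"
proof (rule Bochner_Integration.integrable_bound[where f="\<lambda>r. gker \<beta> (t - a) * v r"])
  show "(\<lambda>r. gker \<beta> (t - r) * v r) \<in> borel_measurable lborel"
    using borel_measurable_integrable[OF assms(2)] by measurable
  have "\<bar>gker \<beta> (t - r) * v r\<bar> \<le> \<bar>gker \<beta> (t - a) * v r\<bar>" for r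
  proof (cases "r < a")
    case False
    then have "gker \<beta> (t - r) \<le> gker \<beta> (t - a)" by (intro gker_mono assms) auto
    then show ?thesis using gker_nonneg[of \<beta>] assms(1) by (simp add: abs_mult mult_right_mono)
  qed (simp add: assms)
  then show "AE r in lborel. norm (gker \<beta> (t - r) * v r) \<le> norm (gker \<beta> (t - a) * v r)" by simp
qed (use assms in simp)

text \<open>Differences of the given integrals are integrals over intervals. Hence the right
  averages of \<open>e\<close> over short intervals below \<open>b\<close> vanish, and almost
  everywhere they converge to \<open>e\<close>.\<close>

lemma AE_eq_0_if_integrals_eq_0:
  assumes int: "integrable lborel e"
    and 0: "\<And>t. t \<le> b \<Longrightarrow> (LINT r|lborel. gker 1 (t - r) * e r) = 0"
  shows "AE x in lborel. x < b \<longrightarrow> e x = (0::real)"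
proof -
  have "e integrable_on cbox x y" for x y
    using integrable_on_lborel[OF int] by (meson integrable_on_subcbox top_greatest)
  then obtain N where N: "negligible N"
    "\<And>x \<epsilon>. x \<notin> N \<Longrightarrow> 0 < \<epsilon> \<Longrightarrow> \<exists>d>0. \<forall>h. 0 < h \<and> h < d \<longrightarrow>
      norm (integral (cbox x (x + h *\<^sub>R One)) e /\<^sub>R h ^ DIM(real) - e x) < \<epsilon>"
    by (rule integrable_ccontinuous_explicit) blast
  have int0: "integral {x..y} e = 0" if "x < y" "y \<le> b" for x y
  proof -
    have i: "integrable lborel (\<lambda>r. gker 1 (t - r) * e r)" for t
      unfolding gker_1_diff using integrable_mult_indicator[OF _ int, of "{..<t}"] by simp
    have "integral {x..y} e = integral {x..<y} e"
      by (rule integral_subset_negligible[symmetric]) (auto intro: negligible_subset[of "{y}"])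
    also have "\<dots> = (LINT r:{x..<y}|lborel. e r)"
      by (rule set_borel_integral_eq_integral(2)[symmetric])
        (use integrable_mult_indicator[OF _ int, of "{x..<y}"] in \<open>simp add: set_integrable_def\<close>)
    also have "\<dots> = (LINT r|lborel. gker 1 (y - r) * e r - gker 1 (x - r) * e r)"
      unfolding set_lebesgue_integral_def
      by (intro Bochner_Integration.integral_cong) (use that in \<open>auto simp: gker_1_diff indicator_def\<close>)
    also have "\<dots> = 0" using 0[of x] 0[of y] that i by simp
    finally show ?thesis .
  qed
  have "e x = 0" if x: "x < b" "x \<notin> N" for x
  proof (rule ccontr)
    assume "e x \<noteq> 0"
    then obtain d where d: "d > 0" "\<And>h. 0 < h \<Longrightarrow> h < d \<Longrightarrow> norm (integral {x..x+h} e / h - e x) < \<bar>e x\<bar>"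
      using N(2)[OF x(2), of "\<bar>e x\<bar>"] by (auto simp: divide_inverse mult.commute)
    \<comment> \<open>Halving \<open>d\<close> makes the length strictly smaller than
      \<open>d\<close>; the bound \<open>b - x\<close> keeps the interval in the range where the
      integrals vanish.\<close>
    have "integral {x..x + min (d/2) (b - x)} e = 0" using x d by (intro int0) auto
    moreover have "0 < min (d/2) (b - x)" "min (d/2) (b - x) < d" using d(1) x by auto
    ultimately show False using d(2)[of "min (d/2) (b - x)"] by simp
  qed
  moreover have "AE x in lborel. x \<notin> N"
  proof -
    have "AE x in lebesgue. x \<notin> N" using N(1) by (intro AE_not_in) (simp add: negligible_iff_null_sets)
    then show ?thesis by (simp add: AE_completion_iff)
  qed
  ultimately show ?thesis by (auto elim: eventually_mono)
qed

text \<open>Convolution with the kernel g of order \<open>\<alpha>\<close> turns the left side into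
  the primitive of \<open>f\<close> and the right side, by associativity, into the primitive of the
  convolution of g and \<open>v\<close>. Equal primitives have equal derivatives almost
  everywhere.\<close>

lemma Abel_inversion:
  assumes \<alpha>: "0 < \<alpha>" "\<alpha> < 1"
    and f: "integrable lborel f" and v: "integrable lborel v"
    and supp: "\<And>r. r < a \<Longrightarrow> v r = 0"
    and eq: "AE s in lborel. s < b \<longrightarrow>
      (LINT r|lborel. gker (1 - \<alpha>) (s - r) * f r) = (LINT r|lborel. gker 1 (s - r) * v r)"
  shows "AE t in lborel. t < b \<longrightarrow> integrable lborel (\<lambda>r. gker \<alpha> (t - r) * v r)"
    and "AE t in lborel. t < b \<longrightarrow> f t = (LINT r|lborel. gker \<alpha> (t - r) * v r)"
proof -
  have [measurable]: "f \<in> borel_measurable borel" "v \<in> borel_measurable borel"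
    using borel_measurable_integrable[OF f] borel_measurable_integrable[OF v] by simp_all
  define gv where "gv t = (LINT r|lborel. gker \<alpha> (t - r) * v r)" for t
  have [measurable]: "gv \<in> borel_measurable borel" unfolding gv_def by measurable
  have int1: "integrable lborel (\<lambda>r. gker 1 (t - r) * f r)" for t
    unfolding gker_1_diff using integrable_mult_indicator[OF _ f, of "{..<t}"] by simp
  have conv1: "has_bochner_integral lborel (\<lambda>y. gker \<alpha> (x - y) * gker (1 - \<alpha>) y) (gker 1 x)" for x
    using gker_convolution[of \<alpha> "1 - \<alpha>" x] \<alpha> by simp
  have conv2: "has_bochner_integral lborel (\<lambda>y. gker \<alpha> (x - y) * gker 1 y) (gker (\<alpha> + 1) x)" for x
    using gker_convolution[of \<alpha> 1 x] \<alpha> by simp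
  have conv3: "has_bochner_integral lborel (\<lambda>y. gker 1 (x - y) * gker \<alpha> y) (gker (\<alpha> + 1) x)" for x
    using gker_convolution[of 1 \<alpha> x] \<alpha> by (simp add: add.commute)
  note v' = integrable_gker_mult[OF _ v supp, of "\<alpha> + 1"]
  have A: "(LINT s|lborel. gker \<alpha> (t - s) * (LINT r|lborel. gker (1 - \<alpha>) (s - r) * f r)) = (LINT r|lborel. gker 1 (t - r) * f r)" for t
    by (rule convolution_assoc_lborel(2)[OF _ _ _ _ _ conv1 int1]) (use \<alpha> gker_nonneg in auto)
  have B: "(LINT s|lborel. gker \<alpha> (t - s) * (LINT r|lborel. gker 1 (s - r) * v r)) = (LINT r|lborel. gker (\<alpha> + 1) (t - r) * v r)" for t
    by (rule convolution_assoc_lborel(2)[OF _ _ _ _ _ conv2 v']) (use \<alpha> gker_nonneg in auto)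
  have C: "integrable lborel (\<lambda>s. gker 1 (t - s) * gv s)"
    "(LINT s|lborel. gker 1 (t - s) * gv s) = (LINT r|lborel. gker (\<alpha> + 1) (t - r) * v r)"
    "AE s in lborel. gker 1 (t - s) \<noteq> 0 \<longrightarrow> integrable lborel (\<lambda>r. gker \<alpha> (s - r) * v r)" for t
    unfolding gv_def
    by (rule convolution_assoc_lborel[OF _ _ _ _ _ conv3 v']; use \<alpha> gker_nonneg in auto)+
  show "AE t in lborel. t < b \<longrightarrow> integrable lborel (\<lambda>r. gker \<alpha> (t - r) * v r)"
    using C(3)[of b] by (auto simp: gker_1_diff elim: eventually_mono)
  have AB: "(LINT r|lborel. gker 1 (t - r) * f r) = (LINT s|lborel. gker 1 (t - s) * gv s)" if "t \<le> b" for t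
  proof -
    have "AE s in lborel. gker \<alpha> (t - s) * (LINT r|lborel. gker (1 - \<alpha>) (s - r) * f r) =
        gker \<alpha> (t - s) * (LINT r|lborel. gker 1 (s - r) * v r)"
      \<comment> \<open>\<open>eq\<close> says nothing for \<open>s \<ge> b\<close>, but there the
        kernel vanishes because \<open>t \<le> b\<close>.\<close>
      using eq by eventually_elim (use that in \<open>auto simp: gker_def[of \<alpha>]\<close>)
    then have "(LINT s|lborel. gker \<alpha> (t - s) * (LINT r|lborel. gker (1 - \<alpha>) (s - r) * f r)) =
        (LINT s|lborel. gker \<alpha> (t - s) * (LINT r|lborel. gker 1 (s - r) * v r))"
      by (intro integral_cong_AE) measurable
    then show ?thesis using A B C(2) by simp
  qed
  \<comment> \<open>The cut-off at \<open>b\<close> makes the difference integrable on the whole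
    line; \<open>gv\<close> is known to be integrable on left half-lines only.\<close>
  define e where "e s = gker 1 (b - s) * f s - gker 1 (b - s) * gv s" for s
  have "AE x in lborel. x < b \<longrightarrow> e x = 0"
  proof (rule AE_eq_0_if_integrals_eq_0)
    show "integrable lborel e"
      unfolding e_def by (intro Bochner_Integration.integrable_diff int1 C)
    show "(LINT r|lborel. gker 1 (t - r) * e r) = 0" if "t \<le> b" for t
    proof -
      have "gker 1 (t - r) * e r = gker 1 (t - r) * f r - gker 1 (t - r) * gv r" for r
        using that by (simp add: e_def gker_1_diff indicator_def)
      then show ?thesis using int1 C(1) AB[OF that] by simp
    qed
  qed
  then show "AE t in lborel. t < b \<longrightarrow> f t = (LINT r|lborel. gker \<alpha> (t - r) * v r)"
    by eventually_elim (auto simp: e_def gker_1_diff gv_def)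
qed

section \<open>The mean-square modulus of continuity of Abel integrals\<close>

lemma nn_integral_gker_shift_diff:
  assumes \<alpha>: "0 < \<alpha>" "\<alpha> \<le> 1" and s: "0 < s"
  shows "(\<integral>\<^sup>+x. ennreal (\<bar>gker \<alpha> (x + s) - gker \<alpha> x\<bar> * gker 1 (M - x)) \<partial>lborel) \<le> ennreal (2 * gker (\<alpha> + 1) s)"
proof -
  have conv: "has_bochner_integral lborel (\<lambda>x. gker \<alpha> x * gker 1 (z - x)) (gker (\<alpha> + 1) z)" for z
    using gker_convolution[of 1 \<alpha> z] \<alpha> by (simp add: mult.commute add.commute)
  have conv_shift: "has_bochner_integral lborel (\<lambda>x. gker \<alpha> (x + s) * gker 1 (z - x)) (gker (\<alpha> + 1) (z + s))" for z
    using lborel_has_bochner_integral_real_affine_iff[of 1 "\<lambda>x. gker \<alpha> x * gker 1 (z + s - x)" _ s] conv[of "z + s"]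
    by (simp add: algebra_simps)
  \<comment> \<open>For \<open>x < 0\<close> only the shifted kernel can be nonzero, and the first
    term outweighs the second. For \<open>x > 0\<close> the kernel is nonincreasing, so the absolute
    value is the difference of the last two terms. The cut-off at \<open>M\<close> keeps every term
    integrable.\<close>
  let ?R = "\<lambda>x. 2 * (gker \<alpha> (x + s) * gker 1 (0 - x)) - gker \<alpha> (x + s) * gker 1 (M - x) + gker \<alpha> x * gker 1 (M - x)"
  let ?I = "2 * gker (\<alpha> + 1) (0 + s) - gker (\<alpha> + 1) (M + s) + gker (\<alpha> + 1) M"
  have R: "has_bochner_integral lborel ?R ?I"
    by (intro has_bochner_integral_add has_bochner_integral_diff has_bochner_integral_mult_right conv conv_shift)
  \<comment> \<open>At 0 the bound can fail, because \<open>gker \<alpha> 0 = 0\<close> while the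
    kernel is positive at \<open>s\<close>.\<close>
  have pw: "\<bar>gker \<alpha> (x + s) - gker \<alpha> x\<bar> * gker 1 (M - x) \<le> ?R x" if "x \<noteq> 0" for x
  proof (cases "x < 0")
    case True
    then have "gker \<alpha> x = 0" "gker 1 (0 - x) = 1" by (auto simp: gker_def Gamma_1)
    then show ?thesis
      using gker_nonneg[of \<alpha> "x + s"] \<alpha> by (simp add: gker_1_diff indicator_def)
  next
    case False
    then have "gker \<alpha> (x + s) \<le> gker \<alpha> x" using that s \<alpha> by (intro gker_antimono) auto
    then show ?thesis using False that by (simp add: gker_1 indicator_def)
  qed
  have "(\<integral>\<^sup>+x. ennreal (\<bar>gker \<alpha> (x + s) - gker \<alpha> x\<bar> * gker 1 (M - x)) \<partial>lborel) \<le> (\<integral>\<^sup>+x. ennreal (?R x) \<partial>lborel)"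
  proof (rule nn_integral_mono_AE)
    show "AE x in lborel. ennreal (\<bar>gker \<alpha> (x + s) - gker \<alpha> x\<bar> * gker 1 (M - x)) \<le> ennreal (?R x)"
      using AE_lborel_singleton[of "0::real"] by eventually_elim (intro ennreal_leI pw)
  qed
  also have "\<dots> = ennreal ?I"
  proof -
    have "AE x in lborel. 0 \<le> ?R x"
      using AE_lborel_singleton[of "0::real"]
    proof eventually_elim
      case (elim x)
      have "0 \<le> \<bar>gker \<alpha> (x + s) - gker \<alpha> x\<bar> * gker 1 (M - x)" by (simp add: gker_1)
      also have "\<dots> \<le> ?R x" using elim by (rule pw)
      finally show ?case .
    qed
    then show ?thesis using R by (subst nn_integral_eq_integral) (auto simp: has_bochner_integral_iff)
  qed
  also have "\<dots> \<le> ennreal (2 * gker (\<alpha> + 1) s)"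
    using gker_mono[of "\<alpha> + 1" M "M + s"] \<alpha> s by (intro ennreal_leI) auto
  finally show ?thesis .
qed

lemma AE_lborel_shift:
  fixes P :: "real \<Rightarrow> bool"
  assumes "AE t in lborel. P t"
  shows "AE t in lborel. P (t + s)"
proof -
  have "AE t in lebesgue. P t" using assms by (rule AE_completion)
  then obtain N where N: "negligible N" "{t. \<not> P t} \<subseteq> N"
    unfolding eventually_ae_filter_negligible by blast
  have "AE t in lebesgue. P (t + s)"
    unfolding eventually_ae_filter_negligible
  proof (intro exI conjI)
    show "negligible ((\<lambda>x. x + s) -` N)" by (rule negligible_vimage_translation[OF N(1)])
    show "{t. \<not> P (t + s)} \<subseteq> (\<lambda>x. x + s) -` N" using N(2) by blast
  qed
  then show ?thesis by (simp add: AE_completion_iff)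
qed

text \<open>The increment of \<open>f\<close> is the convolution of \<open>v\<close> with the
  increment of the kernel, and Young's inequality applies. The constant
  \<open>gker (\<alpha> + 1) s\<close> is of order s to the power \<alpha>.\<close>

lemma L2_modulus_of_continuity:
  assumes \<alpha>: "0 < \<alpha>" "\<alpha> \<le> 1" and s: "0 < s"
    and v [measurable]: "v \<in> borel_measurable borel"
    and supp: "\<And>r. r < a \<Longrightarrow> v r = 0"
    and int: "AE t in lborel. t < b \<longrightarrow> integrable lborel (\<lambda>r. gker \<alpha> (t - r) * v r)"
    and eq: "AE t in lborel. t < b \<longrightarrow> f t = (LINT r|lborel. gker \<alpha> (t - r) * v r)"
  shows "(\<integral>\<^sup>+t. indicator {..<b-s} t * ennreal ((f (t + s) - f t)\<^sup>2) \<partial>lborel) \<le>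
    (ennreal (2 * gker (\<alpha> + 1) s))\<^sup>2 * (\<integral>\<^sup>+r. ennreal ((v r)\<^sup>2) \<partial>lborel)"
proof -
  \<comment> \<open>\<open>t < b\<close> and \<open>r \<ge> a\<close> force
    \<open>t - r < b - a\<close>, so truncating there loses nothing and matches the estimate for the
    truncated kernel increment.\<close>
  define D where "D x = \<bar>gker \<alpha> (x + s) - gker \<alpha> x\<bar> * gker 1 (b - a - x)" for x
  have D [measurable]: "D \<in> borel_measurable borel" unfolding D_def by measurable
  have int_s: "AE t in lborel. t + s < b \<longrightarrow> integrable lborel (\<lambda>r. gker \<alpha> (t + s - r) * v r)"
    by (rule AE_lborel_shift[OF int])
  have eq_s: "AE t in lborel. t + s < b \<longrightarrow> f (t + s) = (LINT r|lborel. gker \<alpha> (t + s - r) * v r)"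
    by (rule AE_lborel_shift[OF eq])
  have "AE t in lborel. indicator {..<b-s} t * ennreal ((f (t + s) - f t)\<^sup>2) \<le> (\<integral>\<^sup>+r. D (t - r) * ennreal \<bar>v r\<bar> \<partial>lborel)\<^sup>2"
    using int eq int_s eq_s
  proof eventually_elim
    case (elim t)
    show ?case
    proof (cases "t < b - s")
      case True
      then have t: "t < b" "t + s < b" using s by auto
      have "f (t + s) - f t = (LINT r|lborel. gker \<alpha> (t + s - r) * v r - gker \<alpha> (t - r) * v r)"
        using elim t by (simp only: simp_thms Bochner_Integration.integral_diff)
      then have "ennreal \<bar>f (t + s) - f t\<bar> \<le> (\<integral>\<^sup>+r. ennreal (norm (gker \<alpha> (t + s - r) * v r - gker \<alpha> (t - r) * v r)) \<partial>lborel)"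
        using integral_norm_bound_ennreal[of lborel "\<lambda>r. gker \<alpha> (t + s - r) * v r - gker \<alpha> (t - r) * v r"] elim t
        by (simp only: simp_thms Bochner_Integration.integrable_diff real_norm_def)
      also have "\<dots> = (\<integral>\<^sup>+r. D (t - r) * ennreal \<bar>v r\<bar> \<partial>lborel)"
      proof (rule nn_integral_cong)
        fix r
        have "norm (gker \<alpha> (t + s - r) * v r - gker \<alpha> (t - r) * v r) = D (t - r) * \<bar>v r\<bar>"
        proof (cases "r < a")
          case False
          then have "gker 1 (b - a - (t - r)) = 1" using t by (simp add: gker_1)
          moreover have "t + s - r = t - r + s" by simp
          moreover have "\<bar>x * v r - y * v r\<bar> = \<bar>x - y\<bar> * \<bar>v r\<bar>" for x y
            by (simp add: abs_mult[symmetric] left_diff_distrib)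
          ultimately show ?thesis by (simp only: D_def real_norm_def)
        qed (simp add: supp)
        then show "ennreal (norm (gker \<alpha> (t + s - r) * v r - gker \<alpha> (t - r) * v r)) = D (t - r) * ennreal \<bar>v r\<bar>"
          by (simp add: ennreal_mult'')
      qed
      finally have "ennreal \<bar>f (t + s) - f t\<bar> \<le> (\<integral>\<^sup>+r. D (t - r) * ennreal \<bar>v r\<bar> \<partial>lborel)" .
      then have "(ennreal \<bar>f (t + s) - f t\<bar>)\<^sup>2 \<le> (\<integral>\<^sup>+r. D (t - r) * ennreal \<bar>v r\<bar> \<partial>lborel)\<^sup>2"
        by (rule power_mono) simp
      then show ?thesis using True by (simp add: ennreal_power)
    qed simp
  qed
  then have "(\<integral>\<^sup>+t. indicator {..<b-s} t * ennreal ((f (t + s) - f t)\<^sup>2) \<partial>lborel) \<le>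
      (\<integral>\<^sup>+t. (\<integral>\<^sup>+r. D (t - r) * ennreal \<bar>v r\<bar> \<partial>lborel)\<^sup>2 \<partial>lborel)"
    by (rule nn_integral_mono_AE)
  also have "\<dots> \<le> (\<integral>\<^sup>+x. D x \<partial>lborel)\<^sup>2 * (\<integral>\<^sup>+r. (ennreal \<bar>v r\<bar>)\<^sup>2 \<partial>lborel)"
    by (rule Young_L1_L2) (auto simp: D_def gker_1)
  also have "\<dots> \<le> (ennreal (2 * gker (\<alpha> + 1) s))\<^sup>2 * (\<integral>\<^sup>+r. (ennreal \<bar>v r\<bar>)\<^sup>2 \<partial>lborel)"
    unfolding D_def by (intro mult_right_mono power_mono nn_integral_gker_shift_diff assms) auto
  finally show ?thesis by (simp add: ennreal_power)
qed

section \<open>The inequality\<close>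

text \<open>With \<open>q\<close> the conjugate exponent of \<open>p\<close>, the condition on
  \<open>p\<close> says \<open>\<alpha> * q < 1\<close>; hence the power \<open>q\<close> of the
  kernel is a multiple of the Abel kernel of positive order \<open>\<beta>\<close>. Young's
  inequality for products bounds the integrand by two terms whose integrals over a shrinking
  interval tend to 0.\<close>

lemma fractional_integral_tendsto_0:
  fixes f :: "real \<Rightarrow> real"
  assumes \<alpha>: "0 < \<alpha>" "\<alpha> < 1" and p: "p > 1 / (1 - \<alpha>)"
    and f [measurable]: "f \<in> borel_measurable borel" and supp: "\<And>r. r \<le> a \<Longrightarrow> f r = 0"
    and int: "integrable lborel (\<lambda>r. \<bar>f r\<bar> powr p)"
    and c: "\<And>n. a < c n" "c \<longlonglongrightarrow> a"
  shows "(\<lambda>n. LINT r|lborel. gker (1 - \<alpha>) (c n - r) * f r) \<longlonglongrightarrow> 0"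
proof -
  have "1 / (1 - \<alpha>) > 1" using \<alpha> by (simp add: field_simps)
  then have p1: "p > 1" using p by linarith
  have ineq: "p * (1 - \<alpha>) > 1" using p \<alpha> by (simp add: field_simps)
  define q where "q = p / (p - 1)"
  define \<beta> where "\<beta> = 1 - \<alpha> * q"
  define C where "C = Gamma \<beta> / Gamma (1 - \<alpha>) powr q"
  have q: "q > 1" "1 / q + 1 / p = 1" using p1 by (auto simp: q_def field_simps)
  have \<beta>: "\<beta> > 0" using p1 ineq by (simp add: \<beta>_def q_def field_simps)
  have kq: "gker (1 - \<alpha>) x powr q = C * gker \<beta> x" for x
  proof (cases "x > 0")
    case True
    have "Gamma \<beta> > 0" "Gamma (1 - \<alpha>) > 0" using \<alpha> \<beta> by (auto intro: Gamma_real_pos)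
    then show ?thesis
      using True by (simp add: gker_def C_def powr_divide powr_powr \<beta>_def)
  qed (simp add: gker_def)
  have C: "C \<ge> 0" using \<beta> by (simp add: C_def Gamma_real_nonneg)
  \<comment> \<open>The factor \<open>gker 1 (r - a)\<close> confines the kernel to
    \<open>r > a\<close>; the integral of the product is then
    \<open>gker (\<beta> + 1) (z - a)\<close>.\<close>
  define W where "W z r = C / q * (gker \<beta> (z - r) * gker 1 (r - a)) + 1 / p * (indicator {..<z} r * \<bar>f r\<bar> powr p)" for z r
  have conv: "has_bochner_integral lborel (\<lambda>r. gker \<beta> (z - r) * gker 1 (r - a)) (gker (\<beta> + 1) (z - a))" for z
    using lborel_has_bochner_integral_real_affine_iff[of 1 "\<lambda>r. gker \<beta> (z - r) * gker 1 (r - a)" "gker (\<beta> + 1) (z - a)" a]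
      gker_convolution[of \<beta> 1 "z - a"] \<beta> by (simp add: algebra_simps)
  have intf: "integrable lborel (\<lambda>r. indicator {..<z} r * \<bar>f r\<bar> powr p)" for z
    using integrable_mult_indicator[OF _ int, of "{..<z}"] by simp
  have W: "integrable lborel (W z)"
    "(LINT r|lborel. W z r) = C / q * gker (\<beta> + 1) (z - a) + 1 / p * (LINT r|lborel. indicator {..<z} r * \<bar>f r\<bar> powr p)" for z
    using conv[of z] intf[of z] unfolding W_def by (simp_all add: has_bochner_integral_iff)
  have bound: "\<bar>gker (1 - \<alpha>) (z - r) * f r\<bar> \<le> W z r" for z r
  proof (cases "a < r \<and> r < z")
    case True
    have "gker (1 - \<alpha>) (z - r) * \<bar>f r\<bar> \<le> gker (1 - \<alpha>) (z - r) powr q / q + \<bar>f r\<bar> powr p / p"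
      using q p1 \<alpha> by (intro Youngs_inequality) (auto intro: gker_nonneg)
    then show ?thesis
      using True gker_nonneg[of "1 - \<alpha>" "z - r"] \<alpha> by (simp add: W_def kq gker_1 abs_mult)
  next
    case False
    then have "gker (1 - \<alpha>) (z - r) * f r = 0" using supp by (auto simp: gker_def)
    moreover have "0 \<le> W z r"
      unfolding W_def using C q p1 \<beta>
      by (intro add_nonneg_nonneg mult_nonneg_nonneg) (auto intro: gker_nonneg)
    ultimately show ?thesis by (simp only: abs_zero)
  qed
  have le: "\<bar>LINT r|lborel. gker (1 - \<alpha>) (z - r) * f r\<bar> \<le> (LINT r|lborel. W z r)" for z
  proof -
    have "\<bar>LINT r|lborel. gker (1 - \<alpha>) (z - r) * f r\<bar> \<le> (LINT r|lborel. \<bar>gker (1 - \<alpha>) (z - r) * f r\<bar>)"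
      by (rule integral_abs_bound)
    also have "\<dots> \<le> (LINT r|lborel. W z r)"
      using bound order_trans[OF abs_ge_zero bound] by (intro integral_mono_AE' W) auto
    finally show ?thesis .
  qed
  have "(\<lambda>n. gker (\<beta> + 1) (c n - a)) \<longlonglongrightarrow> 0"
  proof -
    have "(\<lambda>n. (c n - a) powr \<beta> / Gamma (\<beta> + 1)) \<longlonglongrightarrow> 0 powr \<beta> / Gamma (\<beta> + 1)"
      using c \<beta> tendsto_diff[OF c(2) tendsto_const[of a]] less_imp_le[OF c(1)]
      by (intro tendsto_divide tendsto_powr' tendsto_const) (auto simp: Gamma_real_pos less_imp_neq[symmetric])
    then show ?thesis using c(1) by (simp add: gker_def)
  qed
  moreover have "(\<lambda>n. LINT r|lborel. indicator {..<c n} r * \<bar>f r\<bar> powr p) \<longlonglongrightarrow> integral\<^sup>L lborel (\<lambda>r::real. 0::real)"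
  proof (rule integral_dominated_convergence[where w="\<lambda>r. \<bar>f r\<bar> powr p"])
    have "(\<lambda>n. indicator {..<c n} r * \<bar>f r\<bar> powr p) \<longlonglongrightarrow> 0" for r
    proof (cases "r \<le> a")
      case False
      then have "\<forall>\<^sub>F n in sequentially. c n < r" using c(2) by (intro order_tendstoD(2)) auto
      then have "\<forall>\<^sub>F n in sequentially. 0 = indicator {..<c n} r * \<bar>f r\<bar> powr p"
        by eventually_elim auto
      then show ?thesis by (rule Lim_transform_eventually[OF tendsto_const])
    qed (simp add: supp)
    then show "AE r in lborel. (\<lambda>n. indicator {..<c n} r * \<bar>f r\<bar> powr p) \<longlonglongrightarrow> 0" by simp
  qed (use int in \<open>auto simp: indicator_def\<close>)
  ultimately have "(\<lambda>n. LINT r|lborel. W (c n) r) \<longlonglongrightarrow> C / q * 0 + 1 / p * integral\<^sup>L lborel (\<lambda>r::real. 0::real)"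
    unfolding W(2) by (intro tendsto_intros)
  then have "(\<lambda>n. LINT r|lborel. W (c n) r) \<longlonglongrightarrow> 0" by simp
  then show ?thesis
    by (rule Lim_null_comparison[rotated]) (simp add: le)
qed

text \<open>The lower limit of the integral identity tends to \<open>a\<close> along points outside
  the exceptional null set; they exist because a null set contains no interval. The vanishing limit
  of \<open>u\<close> removes the constant of integration.\<close>

lemma weak_derivative_eq_integral_from_left:
  assumes wd: "has_weak_derivative a b u v\<^sub>0" and "a < b"
    and v: "integrable lborel v" and eq: "AE r in lebesgue. r \<in> {a..b} \<longrightarrow> v\<^sub>0 r = v r"
    and supp: "\<And>r. r \<le> a \<Longrightarrow> v r = 0"
    and u0: "\<And>c. (\<And>n. a < c n) \<Longrightarrow> c \<longlonglongrightarrow> a \<Longrightarrow> (\<lambda>n. u (c n)) \<longlonglongrightarrow> 0"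
  shows "AE s in lebesgue. s \<in> {a<..<b} \<longrightarrow> u s = (LINT r|lborel. gker 1 (s - r) * v r)"
proof -
  have [measurable]: "v \<in> borel_measurable borel" using borel_measurable_integrable[OF v] by simp
  obtain N where N: "negligible N"
    "\<And>c d. a < c \<Longrightarrow> c < d \<Longrightarrow> d < b \<Longrightarrow> c \<notin> N \<Longrightarrow> d \<notin> N \<Longrightarrow> u d - u c = integral {c..d} v\<^sub>0"
    using weak_derivative_eq_integral[OF wd] by blast
  have ex: "\<exists>z. a < z \<and> z < a + 1 / real (Suc n) \<and> z \<notin> N" for n
  proof (rule ccontr)
    assume "\<not> ?thesis"
    then have "{a<..<a + 1 / real (Suc n)} \<subseteq> N" by auto
    then have "negligible {a<..<a + 1 / real (Suc n)}" using N(1) negligible_subset by blast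
    then show False using open_not_negligible[of "{a<..<a + 1 / real (Suc n)}"] by auto
  qed
  then obtain c where c: "\<And>n. a < c n" "\<And>n. c n < a + 1 / real (Suc n)" "\<And>n. c n \<notin> N" by metis
  have c_lim: "c \<longlonglongrightarrow> a"
  proof (rule tendsto_sandwich[OF _ _ tendsto_const])
    show "(\<lambda>n. a + 1 / real (Suc n)) \<longlonglongrightarrow> a"
      using LIMSEQ_inverse_real_of_nat_add[of a] by (simp add: inverse_eq_divide)
  qed (use c in \<open>auto intro!: always_eventually less_imp_le\<close>)
  have eq_int: "integral {z..s} v\<^sub>0 = (LINT r|lborel. indicator {z..s} r * v r)" if "a < z" "s < b" for z s
  proof -
    have ai: "v\<^sub>0 absolutely_integrable_on {z..s}"
      using wd that by (auto simp: has_weak_derivative_def locally_integrable_def)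
    then have "integral {z..s} v\<^sub>0 = (LINT r|lebesgue. indicator {z..s} r * v\<^sub>0 r)"
      by (subst set_lebesgue_integral_eq_integral(2)[symmetric]) (auto simp: set_lebesgue_integral_def)
    also have "\<dots> = (LINT r|lebesgue. indicator {z..s} r * v r)"
    proof (rule integral_cong_AE)
      show "(\<lambda>r. indicator {z..s} r * v\<^sub>0 r) \<in> borel_measurable lebesgue"
        using ai by (auto simp: set_integrable_def dest: borel_measurable_integrable)
      show "(\<lambda>r. indicator {z..s} r * v r) \<in> borel_measurable lebesgue"
        by (rule measurable_completion) measurable
      show "AE r in lebesgue. indicator {z..s} r * v\<^sub>0 r = indicator {z..s} r * v r"
        using eq by eventually_elim (use that in \<open>auto simp: indicator_def\<close>)
    qed
    also have "\<dots> = (LINT r|lborel. indicator {z..s} r * v r)"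
      by (rule integral_completion) measurable
    finally show ?thesis .
  qed
  have "u s = (LINT r|lborel. gker 1 (s - r) * v r)" if s: "s \<in> {a<..<b}" "s \<notin> N" for s
  proof -
    have "(\<lambda>n. LINT r|lborel. indicator {c n..s} r * v r) \<longlonglongrightarrow> (LINT r|lborel. gker 1 (s - r) * v r)"
    proof (rule integral_dominated_convergence[where w="\<lambda>r. \<bar>v r\<bar>"])
      have "(\<lambda>n. indicator {c n..s} r * v r) \<longlonglongrightarrow> gker 1 (s - r) * v r" if "r \<noteq> s" for r
      proof (cases "r \<le> a")
        case False
        then have "\<forall>\<^sub>F n in sequentially. c n < r" using c_lim by (intro order_tendstoD(2)) auto
        then have "\<forall>\<^sub>F n in sequentially. gker 1 (s - r) * v r = indicator {c n..s} r * v r"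
          by eventually_elim (use that in \<open>auto simp: gker_1_diff indicator_def\<close>)
        then show ?thesis by (rule Lim_transform_eventually[OF tendsto_const])
      qed (simp add: supp)
      then show "AE r in lborel. (\<lambda>n. indicator {c n..s} r * v r) \<longlonglongrightarrow> gker 1 (s - r) * v r"
        using AE_lborel_singleton[of s] by (auto elim: eventually_mono)
    qed (use v in \<open>auto simp: indicator_def\<close>)
    moreover have "\<forall>\<^sub>F n in sequentially. (LINT r|lborel. indicator {c n..s} r * v r) = u s - u (c n)"
    proof -
      have "\<forall>\<^sub>F n in sequentially. c n < s" using c_lim s by (intro order_tendstoD(2)) auto
      then show ?thesis
        by eventually_elim (use N(2) eq_int c s in auto)
    qed
    ultimately have "(\<lambda>n. u s - u (c n)) \<longlonglongrightarrow> (LINT r|lborel. gker 1 (s - r) * v r)"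
      by (rule Lim_transform_eventually)
    moreover have "(\<lambda>n. u s - u (c n)) \<longlonglongrightarrow> u s - 0"
      by (intro tendsto_diff tendsto_const u0 c c_lim)
    ultimately show ?thesis using LIMSEQ_unique by fastforce
  qed
  moreover have "AE s in lebesgue. s \<notin> N" using N(1) by (intro AE_not_in) (simp add: negligible_iff_null_sets)
  ultimately show ?thesis by (auto elim: eventually_mono)
qed

text \<open>The quantity \<open>E h t\<close> after the substitution x = t + h - r; the restriction
  to \<open>x > 0\<close> is implicit in the kernel. The first indicator keeps \<open>t + h\<close>
  below \<open>b\<close>, where the modulus estimate applies.\<close>

definition near_energy :: "real \<Rightarrow> real \<Rightarrow> (real \<Rightarrow> real) \<Rightarrow> real \<Rightarrow> real \<Rightarrow> ennreal" where
  "near_energy \<alpha> b f h t = indicator {..<b-h} t *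
    (\<integral>\<^sup>+x. ennreal (gker (1 - \<alpha>) x) * indicator {..<h} x * ennreal ((f (t + h - x) - f t)\<^sup>2) \<partial>lborel)"

lemma near_energy_measurable [measurable]:
  assumes [measurable]: "f \<in> borel_measurable borel"
  shows "near_energy \<alpha> b f h \<in> borel_measurable borel"
  unfolding near_energy_def[abs_def] by measurable

text \<open>Tonelli's theorem moves the integral over \<open>t\<close> inside. For fixed
  \<open>x\<close> in (0, h) the modulus bound at shift h - x applies, and it is at most the bound
  at \<open>h\<close>. What remains is the integral of the kernel over (0, h).\<close>

lemma nn_integral_near_energy_le:
  assumes \<alpha>: "0 < \<alpha>" "\<alpha> < 1" and f [measurable]: "f \<in> borel_measurable borel"
    and modulus: "\<And>s. 0 < s \<Longrightarrow> (\<integral>\<^sup>+t. indicator {..<b-s} t * ennreal ((f (t + s) - f t)\<^sup>2) \<partial>lborel) \<le>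
      (ennreal (2 * gker (\<alpha> + 1) s))\<^sup>2 * V"
  shows "(\<integral>\<^sup>+t. near_energy \<alpha> b f h t \<partial>lborel) \<le>
    ennreal (gker (2 - \<alpha>) h) * ((ennreal (2 * gker (\<alpha> + 1) h))\<^sup>2 * V)"
proof -
  let ?k = "gker (1 - \<alpha>)" and ?B = "(ennreal (2 * gker (\<alpha> + 1) h))\<^sup>2 * V"
  have "(\<integral>\<^sup>+t. near_energy \<alpha> b f h t \<partial>lborel) =
      (\<integral>\<^sup>+t. \<integral>\<^sup>+x. indicator {..<b-h} t * (ennreal (?k x) * indicator {..<h} x * ennreal ((f (t + h - x) - f t)\<^sup>2)) \<partial>lborel \<partial>lborel)"
    by (simp add: near_energy_def nn_integral_cmult)
  also have "\<dots> = (\<integral>\<^sup>+x. \<integral>\<^sup>+t. indicator {..<b-h} t * (ennreal (?k x) * indicator {..<h} x * ennreal ((f (t + h - x) - f t)\<^sup>2)) \<partial>lborel \<partial>lborel)"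
    by (rule lborel_pair.Fubini') measurable
  also have "\<dots> \<le> (\<integral>\<^sup>+x. ennreal (?k x * gker 1 (h - x)) * ?B \<partial>lborel)"
  proof (rule nn_integral_mono)
    fix x
    show "(\<integral>\<^sup>+t. indicator {..<b-h} t * (ennreal (?k x) * indicator {..<h} x * ennreal ((f (t + h - x) - f t)\<^sup>2)) \<partial>lborel) \<le>
      ennreal (?k x * gker 1 (h - x)) * ?B"
    proof (cases "0 < x \<and> x < h")
      case True
      have "(\<integral>\<^sup>+t. indicator {..<b-h} t * (ennreal (?k x) * indicator {..<h} x * ennreal ((f (t + h - x) - f t)\<^sup>2)) \<partial>lborel) \<le>
          (\<integral>\<^sup>+t. ennreal (?k x) * (indicator {..<b-(h-x)} t * ennreal ((f (t + (h - x)) - f t)\<^sup>2)) \<partial>lborel)"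
        using True by (intro nn_integral_mono) (auto simp: indicator_def algebra_simps)
      also have "\<dots> = ennreal (?k x) * (\<integral>\<^sup>+t. indicator {..<b-(h-x)} t * ennreal ((f (t + (h - x)) - f t)\<^sup>2) \<partial>lborel)"
        by (rule nn_integral_cmult) measurable
      also have "\<dots> \<le> ennreal (?k x) * ((ennreal (2 * gker (\<alpha> + 1) (h - x)))\<^sup>2 * V)"
        using True by (intro mult_left_mono modulus) auto
      also have "\<dots> \<le> ennreal (?k x) * ?B"
        using True \<alpha>
        by (intro mult_left_mono mult_right_mono power_mono ennreal_leI gker_mono) auto
      finally show ?thesis using True by (simp add: gker_1)
    next
      case False
      then have "ennreal (?k x) * indicator {..<h} x = 0" by (auto simp: gker_def)
      then show ?thesis
        by (simp only: mult_zero_left mult_zero_right nn_integral_const zero_le)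
    qed
  qed
  also have "\<dots> = (\<integral>\<^sup>+x. ennreal (?k x * gker 1 (h - x)) \<partial>lborel) * ?B"
    by (rule nn_integral_multc) measurable
  also have "(\<integral>\<^sup>+x. ennreal (?k x * gker 1 (h - x)) \<partial>lborel) = ennreal (gker (2 - \<alpha>) h)"
    using gker_convolution[of 1 "1 - \<alpha>" h] \<alpha>
    by (subst nn_integral_eq_integral)
      (auto simp: has_bochner_integral_iff mult.commute gker_nonneg)
  finally show ?thesis .
qed

text \<open>The square is completed around the fixed value \<open>f t\<close>. It is kept between
  \<open>t\<close> and \<open>t + h\<close>, where the kernel increment is positive, and discarded
  left of \<open>t\<close>, where the increment is nonpositive.\<close>

lemma difference_le_near_energy:
  fixes f :: "real \<Rightarrow> real"
  assumes \<alpha>: "0 < \<alpha>" "\<alpha> < 1" and f [measurable]: "f \<in> borel_measurable borel"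
    and supp: "\<And>r. r \<le> a \<Longrightarrow> f r = 0" and t: "a \<le> t" "0 < h" "t + h < b"
    and int1: "\<And>z. z \<in> {t, t + h} \<Longrightarrow> integrable lborel (\<lambda>r. gker (1 - \<alpha>) (z - r) * f r)"
    and int2: "\<And>z. z \<in> {t, t + h} \<Longrightarrow> integrable lborel (\<lambda>r. gker (1 - \<alpha>) (z - r) * (f r)\<^sup>2)"
  defines "F \<equiv> \<lambda>z. LINT r|lborel. gker (1 - \<alpha>) (z - r) * f r"
    and "G \<equiv> \<lambda>z. LINT r|lborel. gker (1 - \<alpha>) (z - r) * (f r)\<^sup>2"
  shows "ennreal (G (t + h) - G t - 2 * f t * (F (t + h) - F t)) \<le> near_energy \<alpha> b f h t"
proof -
  define k where "k = gker (1 - \<alpha>)"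
  have [measurable]: "k \<in> borel_measurable borel" by (simp add: k_def)
  have int1': "integrable lborel (\<lambda>r. k (t + h - r) * f r)" "integrable lborel (\<lambda>r. k (t - r) * f r)"
    using int1[of "t + h"] int1[of t] by (auto simp: k_def)
  have int2': "integrable lborel (\<lambda>r. k (t + h - r) * (f r)\<^sup>2)" "integrable lborel (\<lambda>r. k (t - r) * (f r)\<^sup>2)"
    using int2[of "t + h"] int2[of t] by (auto simp: k_def)
  have conv: "has_bochner_integral lborel (\<lambda>r. k (z - r) * gker 1 (r - a)) (gker (2 - \<alpha>) (z - a))" for z
    using lborel_has_bochner_integral_real_affine_iff[of 1 "\<lambda>r. k (z - r) * gker 1 (r - a)" "gker (2 - \<alpha>) (z - a)" a]
      gker_convolution[of "1 - \<alpha>" 1 "z - a"] \<alpha> by (simp add: algebra_simps k_def)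
  have conv': "integrable lborel (\<lambda>r. k (z - r) * gker 1 (r - a))"
    "(LINT r|lborel. k (z - r) * gker 1 (r - a)) = gker (2 - \<alpha>) (z - a)" for z
    using conv[of z] by (auto simp: has_bochner_integral_iff)
  define \<kappa> where "\<kappa> r = k (t + h - r) - k (t - r)" for r
  \<comment> \<open>Unlike \<open>f\<close>, the constant \<open>f t\<close> need not vanish for
    \<open>r \<le> a\<close>, so the completed square is cut off at \<open>a\<close>.\<close>
  define Q where "Q r = \<kappa> r * gker 1 (r - a) * (f r - f t)\<^sup>2" for r
  have Q_eq: "Q r = (k (t + h - r) * (f r)\<^sup>2 - k (t - r) * (f r)\<^sup>2) -
      2 * f t * (k (t + h - r) * f r - k (t - r) * f r) +
      (f t)\<^sup>2 * (k (t + h - r) * gker 1 (r - a) - k (t - r) * gker 1 (r - a))" for r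
  proof (cases "r \<le> a")
    case False
    then have "gker 1 (r - a) = 1" by (simp add: gker_1)
    then show ?thesis by (simp add: Q_def \<kappa>_def power2_eq_square algebra_simps)
  qed (simp add: Q_def supp gker_1)
  have Q_int: "integrable lborel Q"
    unfolding Q_eq
    by (intro Bochner_Integration.integrable_add Bochner_Integration.integrable_diff integrable_mult_right int1' int2' conv')
  \<comment> \<open>The added term is the square of \<open>f t\<close> times the integral of
    \<open>\<kappa>\<close> over \<open>r > a\<close>. It is nonnegative because the kernel of order
    \<open>2 - \<alpha>\<close> is nondecreasing.\<close>
  have "G (t + h) - G t - 2 * f t * (F (t + h) - F t) \<le>
      G (t + h) - G t - 2 * f t * (F (t + h) - F t) + (f t)\<^sup>2 * (gker (2 - \<alpha>) (t + h - a) - gker (2 - \<alpha>) (t - a))"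
    using gker_mono[of "2 - \<alpha>" "t - a" "t + h - a"] \<alpha> t by simp
  also have "\<dots> = (LINT r|lborel. Q r)"
    unfolding Q_eq F_def G_def k_def[symmetric] by (simp add: int1' int2' conv')
  also have "\<dots> \<le> (LINT r|lborel. max 0 (Q r))"
    by (intro integral_mono Q_int integrable_max) auto
  finally have "ennreal (G (t + h) - G t - 2 * f t * (F (t + h) - F t)) \<le> ennreal (LINT r|lborel. max 0 (Q r))"
    by (rule ennreal_leI)
  also have "\<dots> = (\<integral>\<^sup>+r. ennreal (max 0 (Q r)) \<partial>lborel)"
    by (intro nn_integral_eq_integral[symmetric] integrable_max Q_int) auto
  also have "\<dots> \<le> (\<integral>\<^sup>+r. ennreal (k (t + h - r)) * indicator {..<h} (t + h - r) * ennreal ((f r - f t)\<^sup>2) \<partial>lborel)"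
  proof (rule nn_integral_mono)
    fix r
    \<comment> \<open>At \<open>r = t\<close> neither the monotonicity of the kernel on the positive
      axis nor the strict indicator applies, but the square vanishes.\<close>
    consider "r < t" | "r = t" | "t < r" by linarith
    then show "ennreal (max 0 (Q r)) \<le> ennreal (k (t + h - r)) * indicator {..<h} (t + h - r) * ennreal ((f r - f t)\<^sup>2)"
    proof cases
      case 1
      then have "k (t + h - r) \<le> k (t - r)"
        unfolding k_def using \<alpha> t by (intro gker_antimono) auto
      then have "Q r \<le> 0"
        unfolding Q_def \<kappa>_def by (intro mult_nonpos_nonneg) (auto simp: gker_1)
      then show ?thesis by (simp add: max_def)
    next
      case 3
      then have "k (t - r) = 0" "gker 1 (r - a) = 1" using t by (auto simp: k_def gker_def[of "1 - \<alpha>"] gker_1)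
      then have "Q r = k (t + h - r) * (f r - f t)\<^sup>2" by (simp add: Q_def \<kappa>_def)
      moreover have "0 \<le> k (t + h - r)" using \<alpha> by (simp add: k_def gker_nonneg)
      ultimately show ?thesis using 3 by (simp add: ennreal_mult max_def)
    qed (simp add: Q_def)
  qed
  also have "\<dots> = (\<integral>\<^sup>+x. ennreal (k x) * indicator {..<h} x * ennreal ((f (t + h - x) - f t)\<^sup>2) \<partial>lborel)"
    using nn_integral_real_affine[of "\<lambda>r. ennreal (k (t + h - r)) * indicator {..<h} (t + h - r) * ennreal ((f r - f t)\<^sup>2)" "-1" "t + h"]
    by simp
  also have "\<dots> = near_energy \<alpha> b f h t"
    using t by (simp add: near_energy_def k_def)
  finally show ?thesis .
qed

text \<open>The integrals scale like h^(-1) h^(1 - \<alpha>) h^(2 \<alpha>) = h^\<alpha> with h =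
  1/(n+1). By Fatou's lemma the integral of the lower limit is 0, and a nonnegative function with
  integral 0 vanishes almost everywhere.\<close>

lemma near_energy_liminf:
  assumes \<alpha>: "0 < \<alpha>" "\<alpha> < 1" and f [measurable]: "f \<in> borel_measurable borel"
    and modulus: "\<And>s. 0 < s \<Longrightarrow> (\<integral>\<^sup>+t. indicator {..<b-s} t * ennreal ((f (t + s) - f t)\<^sup>2) \<partial>lborel) \<le>
      (ennreal (2 * gker (\<alpha> + 1) s))\<^sup>2 * V" and V: "V < \<infinity>"
  shows "AE t in lborel. liminf (\<lambda>n. ennreal (real (Suc n)) * near_energy \<alpha> b f (1 / real (Suc n)) t) = 0"
proof -
  obtain c where c: "0 \<le> c" "V = ennreal c" using V by (cases V) auto
  define A B where "A = Gamma (2 - \<alpha>)" and "B = Gamma (\<alpha> + 1)"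
  have AB: "A > 0" "B > 0" using \<alpha> by (simp_all add: A_def B_def Gamma_real_pos)
  define J where "J n t = ennreal (real (Suc n)) * near_energy \<alpha> b f (1 / real (Suc n)) t" for n t
  have [measurable]: "J n \<in> borel_measurable lborel" for n unfolding J_def by measurable
  have bound: "(\<integral>\<^sup>+t. J n t \<partial>lborel) \<le> ennreal (4 * c / (A * B\<^sup>2) * (1 / real (Suc n)) powr \<alpha>)" for n
  proof -
    define x h w where "x = real (Suc n)" and "h = 1 / x" and "w = h powr \<alpha>"
    have h: "x > 0" "h > 0" "x * h = 1" "w > 0" by (auto simp: x_def h_def w_def)
    have "(\<integral>\<^sup>+t. J n t \<partial>lborel) = ennreal x * (\<integral>\<^sup>+t. near_energy \<alpha> b f h t \<partial>lborel)"
      by (simp add: J_def x_def h_def nn_integral_cmult)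
    also have "\<dots> \<le> ennreal x * (ennreal (gker (2 - \<alpha>) h) * ((ennreal (2 * gker (\<alpha> + 1) h))\<^sup>2 * V))"
      by (intro mult_left_mono nn_integral_near_energy_le assms) auto
    also have "\<dots> = ennreal (x * (gker (2 - \<alpha>) h * ((2 * gker (\<alpha> + 1) h)\<^sup>2 * c)))"
      using h c \<alpha> by (simp add: ennreal_mult gker_nonneg ennreal_power)
    also have "x * (gker (2 - \<alpha>) h * ((2 * gker (\<alpha> + 1) h)\<^sup>2 * c)) = 4 * c / (A * B\<^sup>2) * w"
    proof -
      have gk: "gker (2 - \<alpha>) h = h / w / A" "gker (\<alpha> + 1) h = w / B"
        using h powr_diff[of h 1 \<alpha>] by (auto simp: gker_def A_def B_def w_def)
      have "x * (gker (2 - \<alpha>) h * ((2 * gker (\<alpha> + 1) h)\<^sup>2 * c)) = (x * h) * (4 * c / (A * B\<^sup>2) * w)"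
        unfolding gk using h AB by (simp add: field_simps power2_eq_square)
      then show ?thesis using h by simp
    qed
    finally show ?thesis by (simp add: w_def h_def x_def)
  qed
  have "(\<lambda>n. (1 / real (Suc n)) powr \<alpha>) \<longlonglongrightarrow> 0 powr \<alpha>"
    using \<alpha> LIMSEQ_inverse_real_of_nat
    by (intro tendsto_powr') (auto simp: inverse_eq_divide)
  then have "(\<lambda>n. 4 * c / (A * B\<^sup>2) * (1 / real (Suc n)) powr \<alpha>) \<longlonglongrightarrow> 4 * c / (A * B\<^sup>2) * 0"
    by (intro tendsto_mult tendsto_const) simp
  then have lim: "(\<lambda>n. ennreal (4 * c / (A * B\<^sup>2) * (1 / real (Suc n)) powr \<alpha>)) \<longlonglongrightarrow> 0"
    using tendsto_ennrealI by fastforce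
  have "(\<lambda>n. \<integral>\<^sup>+t. J n t \<partial>lborel) \<longlonglongrightarrow> 0"
    by (rule tendsto_sandwich[OF _ _ tendsto_const lim]) (intro always_eventually allI zero_le bound)+
  then have "liminf (\<lambda>n. \<integral>\<^sup>+t. J n t \<partial>lborel) = 0"
    by (rule lim_imp_Liminf[rotated]) simp
  moreover have "(\<integral>\<^sup>+t. liminf (\<lambda>n. J n t) \<partial>lborel) \<le> liminf (\<lambda>n. \<integral>\<^sup>+t. J n t \<partial>lborel)"
    by (rule nn_integral_liminf) measurable
  ultimately have "(\<integral>\<^sup>+t. liminf (\<lambda>n. J n t) \<partial>lborel) = 0" by simp
  then show ?thesis
    unfolding J_def[symmetric] by (subst (asm) nn_integral_0_iff_AE) auto
qed

section \<open>Borel representatives and auxiliary integrability\<close>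

lemma Lp_space_borel_representative:
  assumes u: "u \<in> Lp_space p a b"
  obtains u' where "u' \<in> borel_measurable borel" "\<And>r. r \<notin> {a<..b} \<Longrightarrow> u' r = 0"
    "AE r in lebesgue. zero_ext a b u r = u' r" "integrable lborel (\<lambda>r. \<bar>u' r\<bar> powr p)"
proof -
  \<comment> \<open>Members of the space are only Lebesgue measurable, whereas the Tonelli arguments
    on the product of two copies of \<open>lborel\<close> ask for Borel functions.\<close>
  have "zero_ext a b u \<in> borel_measurable lebesgue"
    using u borel_measurable_if_I[of u "{a..b}"] by (simp add: Lp_space_def zero_ext_def)
  then obtain g where g: "g \<in> borel_measurable lborel" "AE r in lborel. zero_ext a b u r = g r"
    using completion_ex_borel_measurable_real by blast
  \<comment> \<open>Dropping the end point \<open>a\<close> changes a null set only and makes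
    \<open>u'\<close> vanish at every \<open>r \<le> a\<close>.\<close>
  define u' where "u' r = indicator {a<..b} r * g r" for r
  have [measurable]: "u' \<in> borel_measurable borel" using g(1) unfolding u'_def by measurable
  have "AE r in lborel. zero_ext a b u r = u' r"
    using g(2) AE_lborel_singleton[of a] by eventually_elim (auto simp: zero_ext_def u'_def indicator_def split: if_splits)
  then have ae: "AE r in lebesgue. zero_ext a b u r = u' r" by (rule AE_completion)
  have "integrable lebesgue (\<lambda>r. \<bar>zero_ext a b u r\<bar> powr p)"
  proof -
    have "integrable lebesgue (\<lambda>r. indicator {a..b} r *\<^sub>R \<bar>u r\<bar> powr p)"
      using u by (subst integrable_restrict_space[symmetric]) (auto simp: Lp_space_def)
    also have "(\<lambda>r. indicator {a..b} r *\<^sub>R \<bar>u r\<bar> powr p) = (\<lambda>r. \<bar>zero_ext a b u r\<bar> powr p)"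
      by (auto simp: zero_ext_def indicator_def)
    finally show ?thesis .
  qed
  then have "integrable lebesgue (\<lambda>r. \<bar>u' r\<bar> powr p)"
  proof (rule integrable_cong_AE_imp)
    show "(\<lambda>r. \<bar>u' r\<bar> powr p) \<in> borel_measurable lebesgue"
      by (rule measurable_completion) measurable
    show "AE r in lebesgue. \<bar>zero_ext a b u r\<bar> powr p = \<bar>u' r\<bar> powr p"
      using ae by eventually_elim simp
  qed
  then have "integrable lborel (\<lambda>r. \<bar>u' r\<bar> powr p)"
    by (subst (asm) integrable_completion) measurable
  then show thesis by (intro that[of u'] ae) (auto simp: u'_def)
qed

lemma W1p_space_has_weak_deriv:
  assumes "u \<in> W1p_space p a b"
  shows "has_weak_derivative a b u (weak_deriv a b u)"
proof -
  from assms obtain v where "has_weak_derivative a b u v" by (auto simp: W1p_space_def)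
  then show ?thesis unfolding weak_deriv_def by (rule someI[of "has_weak_derivative a b u"])
qed

lemma powr_le_1_plus_powr:
  fixes y :: real
  assumes "0 \<le> y" "0 \<le> s" "s \<le> p"
  shows "y powr s \<le> 1 + y powr p"
proof (cases "y \<le> 1")
  case True
  then have "y powr s \<le> 1" using assms by (simp add: powr_le1)
  then show ?thesis by (smt (verit) powr_ge_zero)
next
  case False
  then have "y powr s \<le> y powr p" using assms by (intro powr_mono) auto
  then show ?thesis by simp
qed

lemma integrable_powr_le:
  fixes u :: "real \<Rightarrow> real"
  assumes [measurable]: "u \<in> borel_measurable borel" and supp: "\<And>r. r \<notin> {a<..b} \<Longrightarrow> u r = 0"
    and int: "integrable lborel (\<lambda>r. \<bar>u r\<bar> powr p)" and "0 \<le> s" "s \<le> p"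
  shows "integrable lborel (\<lambda>r. \<bar>u r\<bar> powr s)"
proof (rule Bochner_Integration.integrable_bound)
  show "integrable lborel (\<lambda>r. indicator {a<..b} r + \<bar>u r\<bar> powr p)"
    by (intro Bochner_Integration.integrable_add int) (cases "a \<le> b"; simp)
  have "\<bar>u r\<bar> powr s \<le> indicator {a<..b} r + \<bar>u r\<bar> powr p" for r
    using powr_le_1_plus_powr[of "\<bar>u r\<bar>" s p] assms by (cases "r \<in> {a<..b}") auto
  then show "AE r in lborel. norm (\<bar>u r\<bar> powr s) \<le> norm (indicator {a<..b} r + \<bar>u r\<bar> powr p)"
    by (auto intro!: always_eventually)
qed measurable

text \<open>A change on a null set does not alter the integral for any \<open>t\<close>. The
  identity therefore holds everywhere, also where the integrand is not integrable and both sides are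
  0.\<close>

lemma gconv_borel_representative:
  assumes [measurable]: "u' \<in> borel_measurable borel" and ae: "AE r in lebesgue. zero_ext a b u r = u' r"
  shows "gconv \<beta> a b u t = (LINT r|lborel. gker \<beta> (t - r) * u' r)"
proof -
  have meas: "u' \<in> borel_measurable lebesgue" "(\<lambda>r. gker \<beta> (t - r)) \<in> borel_measurable lebesgue"
    by (rule measurable_completion; measurable)+
  have "zero_ext a b u \<in> borel_measurable lebesgue"
    by (rule borel_measurable_AE[OF meas(1)]) (use ae in \<open>auto elim: eventually_mono\<close>)
  then have "gconv \<beta> a b u t = (LINT r|lebesgue. gker \<beta> (t - r) * u' r)"
    unfolding gconv_def convolution_def
    by (intro integral_cong_AE borel_measurable_times meas) (use ae in \<open>auto elim: eventually_mono\<close>)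
  then show ?thesis by (subst (asm) integral_completion) measurable
qed

text \<open>Convolution with the kernel of order 1 raises the order to \<open>\<beta> + 1\<close>,
  where integrability holds at every point; Fubini's theorem returns it to almost every inner
  integral.\<close>

lemma AE_integrable_gker_mult:
  assumes "0 < \<beta>" and u: "integrable lborel u" and supp: "\<And>r. r < a \<Longrightarrow> u r = 0"
  shows "AE t in lborel. t < b \<longrightarrow> integrable lborel (\<lambda>r. gker \<beta> (t - r) * u r)"
proof -
  have "AE s in lborel. gker 1 (b - s) \<noteq> 0 \<longrightarrow> integrable lborel (\<lambda>r. gker \<beta> (s - r) * u r)"
  proof (rule convolution_assoc_lborel(3))
    show "has_bochner_integral lborel (\<lambda>y. gker 1 (x - y) * gker \<beta> y) (gker (\<beta> + 1) x)" for x
      using gker_convolution[of 1 \<beta> x] assms by (simp add: add.commute)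
    show "integrable lborel (\<lambda>r. gker (\<beta> + 1) (b - r) * u r)"
      using assms by (intro integrable_gker_mult[OF _ u supp]) auto
  qed (use assms borel_measurable_integrable[OF u] in \<open>auto intro: gker_nonneg\<close>)
  then show ?thesis by eventually_elim (auto simp: gker_1_diff)
qed

theorem theorem39:
  fixes \<alpha> t\<^sub>0 t\<^sub>1 p :: real and f :: "real \<Rightarrow> real"
  assumes "0 < \<alpha>" and "\<alpha> < 1"
    and "t\<^sub>0 < t\<^sub>1"
    and "p > 1 / (1 - \<alpha>)" and "p \<ge> 2"
    and "f \<in> Lp_space p t\<^sub>0 t\<^sub>1"
    and "gconv (1 - \<alpha>) t\<^sub>0 t\<^sub>1 f \<in> W1p_space 2 t\<^sub>0 t\<^sub>1"
    and "gconv (1 - \<alpha>) t\<^sub>0 t\<^sub>1 (\<lambda>t. (f t)\<^sup>2) \<in> W1p_space 1 t\<^sub>0 t\<^sub>1"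
  shows "AE t in lebesgue_on {t\<^sub>0..t\<^sub>1}.
    RL_deriv \<alpha> t\<^sub>0 t\<^sub>1 (\<lambda>s. (f s)\<^sup>2) t \<le> 2 * RL_deriv \<alpha> t\<^sub>0 t\<^sub>1 f t * f t"
proof -
  note \<alpha> = \<open>0 < \<alpha>\<close> \<open>\<alpha> < 1\<close>
  let ?k = "gker (1 - \<alpha>)"
  obtain u where u [measurable]: "u \<in> borel_measurable borel" and u_supp: "\<And>r. r \<notin> {t\<^sub>0<..t\<^sub>1} \<Longrightarrow> u r = 0"
    and fu: "AE r in lebesgue. zero_ext t\<^sub>0 t\<^sub>1 f r = u r" and u_p: "integrable lborel (\<lambda>r. \<bar>u r\<bar> powr p)"
    using Lp_space_borel_representative[OF assms(6)] by blast
  \<comment> \<open>\<open>p \<ge> 2\<close> and the bounded support put \<open>u\<close> into both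
    L^1 and L^2; the latter makes the Abel integral of the square of \<open>u\<close> exist almost
    everywhere.\<close>
  have "integrable lborel (\<lambda>r. \<bar>u r\<bar> powr 1)" "integrable lborel (\<lambda>r. \<bar>u r\<bar> powr 2)"
    by (rule integrable_powr_le[OF u u_supp u_p]; use \<open>p \<ge> 2\<close> in simp)+
  then have u_int: "integrable lborel u" "integrable lborel (\<lambda>r. (u r)\<^sup>2)"
    by (simp_all add: integrable_abs_iff)
  define F G where "F = gconv (1 - \<alpha>) t\<^sub>0 t\<^sub>1 f" and "G = gconv (1 - \<alpha>) t\<^sub>0 t\<^sub>1 (\<lambda>t. (f t)\<^sup>2)"
  have F_eq: "F t = (LINT r|lborel. ?k (t - r) * u r)" for t
    unfolding F_def by (rule gconv_borel_representative[OF u fu])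
  have G_eq: "G t = (LINT r|lborel. ?k (t - r) * (u r)\<^sup>2)" for t
    unfolding G_def
  proof (rule gconv_borel_representative)
    show "AE r in lebesgue. zero_ext t\<^sub>0 t\<^sub>1 (\<lambda>t. (f t)\<^sup>2) r = (u r)\<^sup>2"
      using fu by eventually_elim (auto simp: zero_ext_def split: if_splits)
  qed measurable
  \<comment> \<open>\<open>v\<^sub>0\<close> is the square-integrable weak derivative from the
    hypothesis and feeds the modulus estimate. The representative chosen by
    \<open>weak_deriv\<close> enters only through difference quotients, so the two are never
    compared.\<close>
  obtain v\<^sub>0 where v0: "v\<^sub>0 \<in> Lp_space 2 t\<^sub>0 t\<^sub>1" "has_weak_derivative t\<^sub>0 t\<^sub>1 F v\<^sub>0"
    using assms(7) by (auto simp: W1p_space_def F_def)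
  obtain v where v [measurable]: "v \<in> borel_measurable borel" and v_supp: "\<And>r. r \<notin> {t\<^sub>0<..t\<^sub>1} \<Longrightarrow> v r = 0"
    and v0v: "AE r in lebesgue. zero_ext t\<^sub>0 t\<^sub>1 v\<^sub>0 r = v r" and v_2: "integrable lborel (\<lambda>r. \<bar>v r\<bar> powr 2)"
    using Lp_space_borel_representative[OF v0(1)] by blast
  have "integrable lborel (\<lambda>r. \<bar>v r\<bar> powr 1)"
    by (rule integrable_powr_le[OF v v_supp v_2]) auto
  then have v_int: "integrable lborel v" "integrable lborel (\<lambda>r. (v r)\<^sup>2)"
    using v_2 by (simp_all add: integrable_abs_iff)
  \<comment> \<open>For \<open>s \<le> t\<^sub>0\<close> both integrands vanish identically, which
    extends the identity from the interval to the half-line on which Abel inversion works.\<close>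
  have F_int: "AE s in lborel. s < t\<^sub>1 \<longrightarrow> (LINT r|lborel. ?k (s - r) * u r) = (LINT r|lborel. gker 1 (s - r) * v r)"
  proof -
    have "AE s in lebesgue. s \<in> {t\<^sub>0<..<t\<^sub>1} \<longrightarrow> F s = (LINT r|lborel. gker 1 (s - r) * v r)"
    proof (rule weak_derivative_eq_integral_from_left[OF v0(2) \<open>t\<^sub>0 < t\<^sub>1\<close> v_int(1)])
      show "AE r in lebesgue. r \<in> {t\<^sub>0..t\<^sub>1} \<longrightarrow> v\<^sub>0 r = v r"
        using v0v by eventually_elim (auto simp: zero_ext_def split: if_splits)
      show "(\<lambda>n. F (c n)) \<longlonglongrightarrow> 0" if "\<And>n. t\<^sub>0 < c n" "c \<longlonglongrightarrow> t\<^sub>0" for c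
        unfolding F_eq
        by (rule fractional_integral_tendsto_0[OF \<alpha> assms(4) u _ u_p that]) (use u_supp in auto)
    qed (use v_supp in auto)
    then have "AE s in lborel. s \<in> {t\<^sub>0<..<t\<^sub>1} \<longrightarrow> F s = (LINT r|lborel. gker 1 (s - r) * v r)"
      by (simp add: AE_completion_iff)
    then show ?thesis
    proof eventually_elim
      case (elim s)
      have "(\<lambda>r. ?k (s - r) * u r) = (\<lambda>r. 0)" "(\<lambda>r. gker 1 (s - r) * v r) = (\<lambda>r. 0)" if "s \<le> t\<^sub>0"
        using that u_supp v_supp by (auto simp: gker_def fun_eq_iff)
      then show ?case using elim by (cases "s \<le> t\<^sub>0") (auto simp: F_eq)
    qed
  qed
  have v_supp': "v r = 0" if "r < t\<^sub>0" for r using v_supp that by simp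
  note u_rep = Abel_inversion[OF \<alpha> u_int(1) v_int(1) v_supp' F_int]
  define V where "V = (\<integral>\<^sup>+r. ennreal ((v r)\<^sup>2) \<partial>lborel)"
  have V: "V < \<infinity>"
    using v_int(2) by (simp add: V_def integrable_iff_bounded)
  have energy: "AE t in lborel. liminf (\<lambda>n. ennreal (real (Suc n)) * near_energy \<alpha> t\<^sub>1 u (1 / real (Suc n)) t) = 0"
  proof (rule near_energy_liminf[OF \<alpha> u _ V])
    show "(\<integral>\<^sup>+t. indicator {..<t\<^sub>1-s} t * ennreal ((u (t + s) - u t)\<^sup>2) \<partial>lborel) \<le>
        (ennreal (2 * gker (\<alpha> + 1) s))\<^sup>2 * V" if "0 < s" for s
      unfolding V_def
      by (rule L2_modulus_of_continuity[OF _ _ that v v_supp' u_rep]) (use \<alpha> in auto)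
  qed
  have int_k: "AE t in lborel. t < t\<^sub>1 \<longrightarrow> integrable lborel (\<lambda>r. ?k (t - r) * u r)"
    "AE t in lborel. t < t\<^sub>1 \<longrightarrow> integrable lborel (\<lambda>r. ?k (t - r) * (u r)\<^sup>2)"
    using \<alpha> u_int u_supp by (auto intro!: AE_integrable_gker_mult[where a=t\<^sub>0])
  \<comment> \<open>There are countably many increments, so a single null set serves for all
    shifts.\<close>
  have int_k': "AE t in lborel. \<forall>n. t + 1 / real (Suc n) < t\<^sub>1 \<longrightarrow> integrable lborel (\<lambda>r. ?k (t + 1 / real (Suc n) - r) * u r)"
    "AE t in lborel. \<forall>n. t + 1 / real (Suc n) < t\<^sub>1 \<longrightarrow> integrable lborel (\<lambda>r. ?k (t + 1 / real (Suc n) - r) * (u r)\<^sup>2)"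
    unfolding AE_all_countable using AE_lborel_shift[OF int_k(1)] AE_lborel_shift[OF int_k(2)] by auto
  define w z where "w = RL_deriv \<alpha> t\<^sub>0 t\<^sub>1 f" and "z = RL_deriv \<alpha> t\<^sub>0 t\<^sub>1 (\<lambda>s. (f s)\<^sup>2)"
  have "has_weak_derivative t\<^sub>0 t\<^sub>1 F w"
    unfolding w_def RL_deriv_def F_def by (rule W1p_space_has_weak_deriv[OF assms(7)])
  note F_deriv = weak_derivative_difference_quotient[OF this]
  have "has_weak_derivative t\<^sub>0 t\<^sub>1 G z"
    unfolding z_def RL_deriv_def G_def by (rule W1p_space_has_weak_deriv[OF assms(8)])
  note G_deriv = weak_derivative_difference_quotient[OF this]
  have "AE t in lebesgue. t \<in> {t\<^sub>0<..<t\<^sub>1} \<longrightarrow> z t \<le> 2 * w t * f t"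
    using F_deriv G_deriv AE_completion[OF energy] fu
      AE_completion[OF int_k(1)] AE_completion[OF int_k(2)] AE_completion[OF int_k'(1)] AE_completion[OF int_k'(2)]
  proof eventually_elim
    case (elim t)
    show ?case
    proof
      assume t: "t \<in> {t\<^sub>0<..<t\<^sub>1}"
      then have ft: "f t = u t" using elim(4) by (simp add: zero_ext_def)
      define L where "L n = (G (t + 1 / real (Suc n)) - G t) * real (Suc n) -
        2 * u t * ((F (t + 1 / real (Suc n)) - F t) * real (Suc n))" for n
      have "L \<longlonglongrightarrow> z t - 2 * u t * w t"
        unfolding L_def using elim(1,2) t by (intro tendsto_diff tendsto_mult tendsto_const) auto
      \<comment> \<open>\<open>ennreal\<close> sends negative reals to 0. The comparison of lower
        limits thus shows that the positive part of the limit is 0, which is the claimed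
        sign.\<close>
      then have "(\<lambda>n. ennreal (L n)) \<longlonglongrightarrow> ennreal (z t - 2 * u t * w t)"
        by (rule tendsto_ennrealI)
      then have "ennreal (z t - 2 * u t * w t) = liminf (\<lambda>n. ennreal (L n))"
        by (rule lim_imp_Liminf[symmetric, rotated]) simp
      also have "\<dots> \<le> liminf (\<lambda>n. ennreal (real (Suc n)) * near_energy \<alpha> t\<^sub>1 u (1 / real (Suc n)) t)"
      proof (rule Liminf_mono)
        have "(\<lambda>n. 1 / real (Suc n)) \<longlonglongrightarrow> 0"
          using LIMSEQ_inverse_real_of_nat by (simp add: inverse_eq_divide)
        then have "\<forall>\<^sub>F n in sequentially. 1 / real (Suc n) < t\<^sub>1 - t"
          using t by (intro order_tendstoD(2)) auto
        then show "\<forall>\<^sub>F n in sequentially. ennreal (L n) \<le> ennreal (real (Suc n)) * near_energy \<alpha> t\<^sub>1 u (1 / real (Suc n)) t"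
        proof eventually_elim
          case (elim n)
          define h where "h = 1 / real (Suc n)"
          have h: "0 < h" "t + h < t\<^sub>1" using elim by (auto simp: h_def)
          have int: "integrable lborel (\<lambda>r. ?k (s - r) * u r)" "integrable lborel (\<lambda>r. ?k (s - r) * (u r)\<^sup>2)"
            if "s \<in> {t, t + h}" for s
            using that h t \<open>t < t\<^sub>1 \<longrightarrow> integrable lborel (\<lambda>r. ?k (t - r) * u r)\<close>
              \<open>t < t\<^sub>1 \<longrightarrow> integrable lborel (\<lambda>r. ?k (t - r) * (u r)\<^sup>2)\<close>
              \<open>\<forall>n. t + 1 / real (Suc n) < t\<^sub>1 \<longrightarrow> integrable lborel (\<lambda>r. ?k (t + 1 / real (Suc n) - r) * u r)\<close>
              \<open>\<forall>n. t + 1 / real (Suc n) < t\<^sub>1 \<longrightarrow> integrable lborel (\<lambda>r. ?k (t + 1 / real (Suc n) - r) * (u r)\<^sup>2)\<close>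
            by (auto simp: h_def)
          have "L n = real (Suc n) * (G (t + h) - G t - 2 * u t * (F (t + h) - F t))"
            by (simp add: L_def h_def algebra_simps)
          also have "ennreal \<dots> = ennreal (real (Suc n)) * ennreal (G (t + h) - G t - 2 * u t * (F (t + h) - F t))"
            by (rule ennreal_mult') simp
          also have "\<dots> \<le> ennreal (real (Suc n)) * near_energy \<alpha> t\<^sub>1 u h t"
            unfolding F_eq G_eq
            by (intro mult_left_mono difference_le_near_energy[OF \<alpha> u, of t\<^sub>0]) (use u_supp t h int in auto)
          finally show ?case by (simp add: h_def)
        qed
      qed
      also have "\<dots> = 0" using elim(3) .
      finally have "z t - 2 * u t * w t \<le> 0" by (simp add: ennreal_eq_0_iff)
      then show "z t \<le> 2 * w t * f t" by (simp add: ft mult_ac)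
    qed
  qed
  moreover have "AE t in lebesgue. t \<noteq> t\<^sub>0 \<and> t \<noteq> t\<^sub>1"
    using AE_completion[OF AE_lborel_singleton[of t\<^sub>0]] AE_completion[OF AE_lborel_singleton[of t\<^sub>1]]
    by eventually_elim simp
  ultimately have "AE t in lebesgue. t \<in> {t\<^sub>0..t\<^sub>1} \<longrightarrow> z t \<le> 2 * w t * f t"
    by eventually_elim auto
  then show ?thesis
    unfolding w_def z_def by (subst AE_restrict_space_iff) auto
qed

end
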